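(* Let $\mathcal H=\{h_m(x)=r_mx+u_m\}_{m=1}^M$ be a self-similar IFS on the real line ($r_m\in(0,1)$, $u_m\in\mathbb R$). Then $\mathcal H$ has No Dimension Drop if and only if $\mathcal H$ has Weak Almost Unique Coding.
   Context: Let $\Lambda_{\mathcal H}$ be the attractor of $\mathcal H$, $\Sigma_{\mathcal H}=\{1,\dots,M\}^{\mathbb N}$, $\Pi_{\mathcal H}(\mathbf m)=\lim_nh_{m_1}\circ\dots\circ h_{m_n}(0)$ for $\mathbf m=m_1m_2\dots\in\Sigma_{\mathcal H}$, and $\xi(\mathbf m)=\Pi_{\mathcal H}^{-1}\Pi_{\mathcal H}(\mathbf m)$. For a probability vector $\mathbf q=(q_1,\dots,q_M)$, $\mu_{\mathbf q}=\mathbf q^{\mathbb N}$ is the Bernoulli measure on $\Sigma_{\mathcal H}$ and $\nu_{\mathbf q}=(\Pi_{\mathcal H})_*\mu_{\mathbf q}$. No Dimension Drop (NDD): for every probability vector $\mathbf q$ with strictly positive entries, $\dim_{\rm H}\nu_{\mathbf q}=\dfrac{-\sum_mq_m\log q_m}{-\sum_mq_m\log r_m}$. Weak Almost Unique Coding (WAUC): for every probability vector $\mathbf q$ with strictly positive entries there is a set $\mathcal B_{\mathcal H}\subset\Sigma_{\mathcal H}$ (which may depend on $\mathbf q$) with $\mu_{\mathbf q}(\mathcal B_{\mathcal H})=0$ and such that for every $\mathbf m\in\Sigma_{\mathcal H}\setminus\mathcal B_{\mathcal H}$ we have $\#(\xi(\mathbf m)\setminus\mathcal B_{\mathcal H})=1$.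 *)

theory Defs
  imports "HOL-Probability.Probability"
begin

section \<open>Hausdorff dimension\<close>

text \<open>The term \<open>diam(U)^s\<close> of a Hausdorff sum, with the usual conventions: the empty set contributes
  \<open>0\<close>, and a nonempty set contributes \<open>1\<close> for \<open>s = 0\<close> (whereas \<open>0 powr 0 = 0\<close>).\<close>

definition hausdorff_weight :: "real \<Rightarrow> 'a::metric_space set \<Rightarrow> ennreal" where
  "hausdorff_weight s U =
     (if U = {} then 0 else if s = 0 then 1 else ennreal (diameter U powr s))"

text \<open>Boundedness is required because \<^const>\<open>diameter\<close> is unspecified on unbounded sets.  Finite covers
  are included, as members of the sequence may be empty.\<close>

definition delta_covers :: "real \<Rightarrow> 'a::metric_space set \<Rightarrow> (nat \<Rightarrow> 'a set) set" where
  "delta_covers \<delta> A = {U. A \<subseteq> (\<Union>i. U i) \<and> (\<forall>i. bounded (U i) \<and> diameter (U i) \<le> \<delta>)}"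

definition hausdorff_premeasure :: "real \<Rightarrow> real \<Rightarrow> 'a::metric_space set \<Rightarrow> ennreal" where
  "hausdorff_premeasure s \<delta> A = (INF U\<in>delta_covers \<delta> A. \<Sum>i. hausdorff_weight s (U i))"

definition hausdorff_measure :: "real \<Rightarrow> 'a::metric_space set \<Rightarrow> ennreal" where
  "hausdorff_measure s A = (SUP \<delta>\<in>{0<..}. hausdorff_premeasure s \<delta> A)"

definition hausdorff_dim :: "'a::metric_space set \<Rightarrow> ereal" where
  "hausdorff_dim A = (INF s\<in>{s. 0 \<le> s \<and> hausdorff_measure s A = 0}. ereal s)"

text \<open>Intended for Borel probability measures.\<close>

definition hausdorff_dim_measure :: "'a::metric_space measure \<Rightarrow> ereal" where
  "hausdorff_dim_measure N = (INF A\<in>{A \<in> sets N. emeasure N A = 1}. hausdorff_dim A)"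

section \<open>Self-similar iterated function systems on the line\<close>

text \<open>A system is given by the number \<open>M\<close> of its maps and by the functions \<open>r\<close>, \<open>u\<close>, of which only the
  values on \<open>{1..M}\<close> matter.  A coding sequence \<open>m\<^sub>1 m\<^sub>2 \<dots>\<close> is a function on \<^typ>\<open>nat\<close>
  whose value at \<open>k\<close> is the symbol \<open>m\<^sub>k\<^sub>+\<^sub>1\<close>.\<close>

definition ifs_map :: "(nat \<Rightarrow> real) \<Rightarrow> (nat \<Rightarrow> real) \<Rightarrow> nat \<Rightarrow> real \<Rightarrow> real" where
  "ifs_map r u i x = r i * x + u i"

definition symbolic_space :: "nat \<Rightarrow> (nat \<Rightarrow> nat) set" where
  "symbolic_space M = (UNIV \<rightarrow> {1..M})"

primrec cylinder_map :: "(nat \<Rightarrow> real) \<Rightarrow> (nat \<Rightarrow> real) \<Rightarrow> (nat \<Rightarrow> nat) \<Rightarrow> nat \<Rightarrow> real \<Rightarrow> real" where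
  "cylinder_map r u m 0 = id"
| "cylinder_map r u m (Suc n) = cylinder_map r u m n \<circ> ifs_map r u (m n)"

definition coding_map :: "(nat \<Rightarrow> real) \<Rightarrow> (nat \<Rightarrow> real) \<Rightarrow> (nat \<Rightarrow> nat) \<Rightarrow> real" where
  "coding_map r u m = lim (\<lambda>n. cylinder_map r u m n 0)"

definition coding_fibre ::
    "nat \<Rightarrow> (nat \<Rightarrow> real) \<Rightarrow> (nat \<Rightarrow> real) \<Rightarrow> (nat \<Rightarrow> nat) \<Rightarrow> (nat \<Rightarrow> nat) set" where
  "coding_fibre M r u m = {m' \<in> symbolic_space M. coding_map r u m' = coding_map r u m}"

definition positive_prob_vector :: "nat \<Rightarrow> (nat \<Rightarrow> real) \<Rightarrow> bool" where
  "positive_prob_vector M q \<longleftrightarrow> (\<forall>i\<in>{1..M}. 0 < q i) \<and> (\<Sum>i\<in>{1..M}. q i) = 1"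

definition bernoulli_measure :: "nat \<Rightarrow> (nat \<Rightarrow> real) \<Rightarrow> (nat \<Rightarrow> nat) measure" where
  "bernoulli_measure M q = (\<Pi>\<^sub>M k\<in>(UNIV :: nat set). point_measure {1..M} (\<lambda>i. ennreal (q i)))"

definition self_similar_measure ::
    "nat \<Rightarrow> (nat \<Rightarrow> real) \<Rightarrow> (nat \<Rightarrow> real) \<Rightarrow> (nat \<Rightarrow> real) \<Rightarrow> real measure" where
  "self_similar_measure M r u q = distr (bernoulli_measure M q) borel (coding_map r u)"

definition no_dimension_drop :: "nat \<Rightarrow> (nat \<Rightarrow> real) \<Rightarrow> (nat \<Rightarrow> real) \<Rightarrow> bool" where
  "no_dimension_drop M r u \<longleftrightarrow>
     (\<forall>q. positive_prob_vector M q \<longrightarrow>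
        hausdorff_dim_measure (self_similar_measure M r u q) =
          ereal ((- (\<Sum>i\<in>{1..M}. q i * ln (q i))) / (- (\<Sum>i\<in>{1..M}. q i * ln (r i)))))"

text \<open>In the following definition, \<^term>\<open>card S = 1\<close> implies that \<open>S\<close> is finite,
  since \<^const>\<open>card\<close> vanishes on infinite sets.\<close>

definition weak_almost_unique_coding :: "nat \<Rightarrow> (nat \<Rightarrow> real) \<Rightarrow> (nat \<Rightarrow> real) \<Rightarrow> bool" where
  "weak_almost_unique_coding M r u \<longleftrightarrow>
     (\<forall>q. positive_prob_vector M q \<longrightarrow>
        (\<exists>B \<in> null_sets (bernoulli_measure M q).
           \<forall>m \<in> symbolic_space M - B. card (coding_fibre M r u m - B) = 1))"

end

theory Submission
  imports Defs
begin

text \<open>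
The equivalence holds for each probability vector \<open>q\<close> separately.  Fix \<open>q\<close>, let \<open>\<mu>\<close> be the Bernoulli
measure, \<open>\<nu>\<close> its image under the coding map, \<open>h\<close> the entropy of \<open>q\<close> and \<open>\<chi>\<close> the Lyapunov exponent.
Both properties say that almost surely the first symbol of a sequence is a function of its coded point.

If this fails, there are a symbol \<open>i\<close>, a Borel set \<open>E\<close> and \<open>a < 1\<close> such that over points of \<open>E\<close> the
symbol \<open>i\<close> has conditional probability at most \<open>a\<close> and yet occurs there with positive probability
(\<open>first_digit_decided\<close>).  The conditional probability of a word of length \<open>n\<close>, given the coded
point, is then at most \<open>a\<close> to the number of visits of the orbit to this situation
(\<open>emeasure_cylinder_visits\<close>), and by ergodicity the visits have positive frequency
(\<open>birkhoff_sum_exceeds\<close>).  Hence a typical point is covered by exponentially many typical cylinders, and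
balls around it are heavier than the cylinders suggest.  This gives a set of full measure and dimension
below \<open>h / \<chi>\<close> (\<open>exists_full_null_hausdorff\<close>, \<open>dimension_drop\<close>).  The same lemma with \<open>E\<close> empty and
\<open>a = 1\<close> is the general upper bound \<open>h / \<chi>\<close>.

Conversely, let the coding map be injective off a null set.  By inner regularity, on a compact set \<open>K\<close> of
almost full measure sequences with different first symbols are coded at a distance at least \<open>c > 0\<close>
(\<open>separated_subset\<close>).  While the orbits of two sequences are in \<open>K\<close>, a ball of radius comparable to
the current contraction ratio determines the next symbol; so only the rare times outside \<open>K\<close> leave a
choice (\<open>card_words_same_bad_times\<close>).  The maximal ergodic theorem provides a set of positive measure on
which, for all \<open>n\<close> at once, the words are small enough to pay for these choices
(\<open>maximal_ergodic\<close>, \<open>frostman_subset\<close>).  The mass distribution principle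
(\<open>hausdorff_measure_pos\<close>) turns this into the lower bound \<open>h / \<chi>\<close>.
\<close>

section \<open>Bernoulli measures and the shift\<close>

definition shift :: "(nat \<Rightarrow> 'a) \<Rightarrow> nat \<Rightarrow> 'a" where
  "shift m = (\<lambda>k. m (Suc k))"

definition birkhoff_sum :: "((nat \<Rightarrow> 'a) \<Rightarrow> real) \<Rightarrow> nat \<Rightarrow> (nat \<Rightarrow> 'a) \<Rightarrow> real" where
  "birkhoff_sum F n m = (\<Sum>k<n. F (\<lambda>j. m (j + k)))"

lemma shift_case_nat [simp]: "shift (case_nat i m) = m"
  by (simp add: shift_def)

lemma birkhoff_sum_0 [simp]: "birkhoff_sum F 0 m = 0"
  by (simp add: birkhoff_sum_def)

lemma birkhoff_sum_Suc: "birkhoff_sum F (Suc n) m = F m + birkhoff_sum F n (shift m)"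
  unfolding birkhoff_sum_def by (subst sum.lessThan_Suc_shift) (simp add: shift_def)

lemma symbolic_space_shift: "m \<in> symbolic_space M \<Longrightarrow> shift m \<in> symbolic_space M"
  by (auto simp: symbolic_space_def shift_def)

lemma symbolic_space_shift_iterate: "m \<in> symbolic_space M \<Longrightarrow> (\<lambda>j. m (j + k)) \<in> symbolic_space M"
  by (auto simp: symbolic_space_def)

lemma symbolic_space_case_nat:
  "i \<in> {1..M} \<Longrightarrow> m \<in> symbolic_space M \<Longrightarrow> case_nat i m \<in> symbolic_space M"
  by (auto simp: symbolic_space_def Pi_iff split: nat.splits)

lemma symbolic_space_digit: "m \<in> symbolic_space M \<Longrightarrow> m k \<in> {1..M}"
  by (auto simp: symbolic_space_def)

locale bernoulli_ifs =
  fixes M :: nat and r u q :: "nat \<Rightarrow> real"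
  assumes ratio: "\<And>i. i \<in> {1..M} \<Longrightarrow> 0 < r i \<and> r i < 1"
    and prob_vector: "positive_prob_vector M q"
begin

abbreviation digit_measure :: "nat measure" where
  "digit_measure \<equiv> point_measure {1..M} (\<lambda>i. ennreal (q i))"

abbreviation \<mu> :: "(nat \<Rightarrow> nat) measure" where
  "\<mu> \<equiv> bernoulli_measure M q"

lemma q_pos: "i \<in> {1..M} \<Longrightarrow> 0 < q i"
  and q_sum: "(\<Sum>i\<in>{1..M}. q i) = 1"
  using prob_vector by (auto simp: positive_prob_vector_def)

lemma q_le_1: "i \<in> {1..M} \<Longrightarrow> q i \<le> 1"
  using member_le_sum[of i "{1..M}" q] q_sum q_pos by (force simp: less_imp_le)

lemma M_pos: "1 \<le> M"
  using q_sum by (cases M) auto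

lemma prob_space_digit_measure: "prob_space digit_measure"
proof
  have "emeasure digit_measure {1..M} = (\<Sum>i\<in>{1..M}. ennreal (q i))"
    by (rule emeasure_point_measure_finite) auto
  also have "\<dots> = ennreal (\<Sum>i\<in>{1..M}. q i)"
    using q_pos by (intro sum_ennreal) (auto simp: less_imp_le)
  finally show "emeasure digit_measure (space digit_measure) = 1"
    by (simp only: space_point_measure q_sum ennreal_1)
qed

sublocale digits: sequence_space digit_measure
  by (intro sequence_space.intro product_prob_spaceI prob_space_digit_measure)

lemma mu_eq: "\<mu> = digits.S"
  by (simp add: bernoulli_measure_def)

sublocale mu: prob_space \<mu>
  unfolding mu_eq by (rule digits.P.prob_space_axioms)

lemma space_mu: "space \<mu> = symbolic_space M"
  by (auto simp: bernoulli_measure_def space_PiM space_point_measure symbolic_space_def)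

lemma measurable_digit [measurable]: "(\<lambda>m. m k) \<in> measurable \<mu> (count_space UNIV)"
proof -
  have "(\<lambda>m. m k) \<in> measurable \<mu> digit_measure"
    unfolding bernoulli_measure_def by (rule measurable_component_singleton) simp
  moreover have "(\<lambda>x. x) \<in> measurable digit_measure (count_space UNIV)"
    by simp
  ultimately show ?thesis
    using measurable_compose by blast
qed

lemma measurable_into_mu:
  assumes "\<And>x. x \<in> space N \<Longrightarrow> f x \<in> symbolic_space M"
    and "\<And>k. (\<lambda>x. f x k) \<in> measurable N (count_space UNIV)"
  shows "f \<in> measurable N \<mu>"
  unfolding bernoulli_measure_def
proof (rule measurable_PiM_single')
  show "f \<in> space N \<rightarrow> (\<Pi>\<^sub>E i\<in>UNIV. space digit_measure)"
    using assms(1) by (auto simp: space_point_measure symbolic_space_def)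
  fix k :: nat
  have "(\<lambda>x. f x k) -` {a} \<inter> space N \<in> sets N" for a
    using measurable_sets[OF assms(2)[of k], of "{a}"] by simp
  then show "(\<lambda>x. f x k) \<in> measurable N digit_measure"
    using assms(1) by (auto simp: symbolic_space_def)
qed

lemma measurable_case_nat_mu: "i \<in> {1..M} \<Longrightarrow> case_nat i \<in> measurable \<mu> \<mu>"
proof (rule measurable_into_mu)
  fix k assume "i \<in> {1..M}"
  show "(\<lambda>m. case_nat i m k) \<in> measurable \<mu> (count_space UNIV)"
    by (cases k) auto
qed (auto simp: space_mu intro!: symbolic_space_case_nat)

lemma measurable_shift [measurable]: "shift \<in> measurable \<mu> \<mu>"
  by (rule measurable_into_mu) (auto simp: space_mu symbolic_space_shift, simp add: shift_def)

lemma measurable_shift_iterate [measurable]: "(\<lambda>m j. m (j + k)) \<in> measurable \<mu> \<mu>"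
  by (rule measurable_into_mu) (auto simp: space_mu symbolic_space_shift_iterate)

text \<open>The self-similarity of \<open>\<mu>\<close>: shift invariance and the inductions on the length of a word rest on
  it.\<close>

lemma nn_integral_first_digit:
  assumes [measurable]: "F \<in> borel_measurable \<mu>"
  shows "(\<integral>\<^sup>+m. F m \<partial>\<mu>) = (\<Sum>i\<in>{1..M}. ennreal (q i) * (\<integral>\<^sup>+m. F (case_nat i m) \<partial>\<mu>))"
proof -
  have ms: "(\<lambda>(s, \<omega>). case_nat s \<omega>) \<in> measurable (digit_measure \<Otimes>\<^sub>M digits.S) digits.S"
    unfolding split_beta' by (rule measurable_case_nat') (auto simp: measurable_fst measurable_snd)
  have F': "F \<in> borel_measurable digits.S"
    using assms unfolding mu_eq .
  have "(\<integral>\<^sup>+m. F m \<partial>digits.S) = (\<integral>\<^sup>+m. F m \<partial>distr (digit_measure \<Otimes>\<^sub>M digits.S) digits.S (\<lambda>(s, \<omega>). case_nat s \<omega>))"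
    by (subst digits.PiM_iter) (rule refl)
  also have "\<dots> = (\<integral>\<^sup>+p. F (case_nat (fst p) (snd p)) \<partial>(digit_measure \<Otimes>\<^sub>M digits.S))"
    using F' ms by (subst nn_integral_distr) (auto simp: split_beta')
  also have "\<dots> = (\<integral>\<^sup>+s. (\<integral>\<^sup>+m. F (case_nat s m) \<partial>digits.S) \<partial>digit_measure)"
    using measurable_compose[OF ms F']
    by (subst digits.P.nn_integral_fst[symmetric]) (auto simp: split_beta')
  also have "\<dots> = (\<Sum>i\<in>{1..M}. ennreal (q i) * (\<integral>\<^sup>+m. F (case_nat i m) \<partial>digits.S))"
    by (rule nn_integral_point_measure_finite) simp
  finally show ?thesis unfolding mu_eq .
qed

lemma emeasure_first_digit:
  assumes "A \<in> sets \<mu>"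
  shows "emeasure \<mu> A =
    (\<Sum>i\<in>{1..M}. ennreal (q i) * emeasure \<mu> {m \<in> symbolic_space M. case_nat i m \<in> A})"
proof -
  have "emeasure \<mu> A = (\<integral>\<^sup>+m. indicator A m \<partial>\<mu>)"
    using assms by simp
  also have "\<dots> = (\<Sum>i\<in>{1..M}. ennreal (q i) * (\<integral>\<^sup>+m. indicator A (case_nat i m) \<partial>\<mu>))"
    using assms by (intro nn_integral_first_digit) auto
  also have "\<dots> = (\<Sum>i\<in>{1..M}. ennreal (q i) * emeasure \<mu> {m \<in> symbolic_space M. case_nat i m \<in> A})"
  proof (rule sum.cong[OF refl])
    fix i assume i: "i \<in> {1..M}"
    have eq: "{m \<in> symbolic_space M. case_nat i m \<in> A} = case_nat i -` A \<inter> space \<mu>"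
      by (auto simp: space_mu)
    have meas: "case_nat i -` A \<inter> space \<mu> \<in> sets \<mu>"
      using measurable_case_nat_mu[OF i] assms by (rule measurable_sets)
    have "(\<integral>\<^sup>+m. indicator A (case_nat i m) \<partial>\<mu>)
        = (\<integral>\<^sup>+m. indicator (case_nat i -` A \<inter> space \<mu>) m \<partial>\<mu>)"
      by (intro nn_integral_cong) (simp add: indicator_def)
    also have "\<dots> = emeasure \<mu> {m \<in> symbolic_space M. case_nat i m \<in> A}"
      unfolding eq by (rule nn_integral_indicator[OF meas])
    finally show "ennreal (q i) * (\<integral>\<^sup>+m. indicator A (case_nat i m) \<partial>\<mu>)
        = ennreal (q i) * emeasure \<mu> {m \<in> symbolic_space M. case_nat i m \<in> A}"
      by simp
  qed
  finally show ?thesis .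
qed

lemma sum_q_ennreal: "(\<Sum>i\<in>{1..M}. ennreal (q i)) = 1"
  using q_pos q_sum by (subst sum_ennreal) (auto simp: less_imp_le)

lemma distr_shift: "distr \<mu> \<mu> shift = \<mu>"
proof (rule measure_eqI)
  fix A assume "A \<in> sets (distr \<mu> \<mu> shift)"
  then have A: "A \<in> sets \<mu>" unfolding sets_distr .
  have B: "shift -` A \<inter> space \<mu> \<in> sets \<mu>"
    using A by measurable
  have "emeasure \<mu> (shift -` A \<inter> space \<mu>) = (\<Sum>i\<in>{1..M}. ennreal (q i) * emeasure \<mu> A)"
    unfolding emeasure_first_digit[OF B]
  proof (intro sum.cong refl arg_cong2[where f="(*)"] arg_cong2[where f=emeasure])
    fix i assume "i \<in> {1..M}"
    then show "{m \<in> symbolic_space M. case_nat i m \<in> shift -` A \<inter> space \<mu>} = A"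
      using sets.sets_into_space[OF A] by (auto simp: space_mu symbolic_space_case_nat)
  qed
  also have "\<dots> = emeasure \<mu> A"
    unfolding sum_distrib_right[symmetric] sum_q_ennreal by (rule mult_1)
  finally show "emeasure (distr \<mu> \<mu> shift) A = emeasure \<mu> A"
    unfolding emeasure_distr[OF measurable_shift A] .
qed (rule sets_distr)

lemma integral_shift:
  fixes F :: "(nat \<Rightarrow> nat) \<Rightarrow> real"
  assumes "F \<in> borel_measurable \<mu>"
  shows "(\<integral>m. F (shift m) \<partial>\<mu>) = (\<integral>m. F m \<partial>\<mu>)"
  using integral_distr[OF measurable_shift assms] by (simp add: distr_shift)

lemma null_set_shift:
  assumes "N \<in> null_sets \<mu>"
  shows "{m \<in> space \<mu>. (\<lambda>j. m (j + k)) \<in> N} \<in> null_sets \<mu>"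
proof (induction k)
  case 0
  have "{m \<in> space \<mu>. m \<in> N} = N"
    using sets.sets_into_space[of N \<mu>] assms by auto
  then show ?case using assms by simp
next
  case (Suc k)
  let ?A = "{m \<in> space \<mu>. (\<lambda>j. m (j + k)) \<in> N}"
  have eq: "{m \<in> space \<mu>. (\<lambda>j. m (j + Suc k)) \<in> N} = shift -` ?A \<inter> space \<mu>"
    by (auto simp: space_mu symbolic_space_shift) (auto simp: shift_def)
  have A: "?A \<in> sets \<mu>"
    using Suc by blast
  have "emeasure \<mu> (shift -` ?A \<inter> space \<mu>) = emeasure \<mu> ?A"
    using emeasure_distr[OF measurable_shift A] unfolding distr_shift by (rule sym)
  then show ?case
    using Suc A measurable_sets[OF measurable_shift A] unfolding eq null_sets_def by simp
qed

lemma birkhoff_sum_measurable [measurable]: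
  "F \<in> borel_measurable \<mu> \<Longrightarrow> birkhoff_sum F n \<in> borel_measurable \<mu>"
  unfolding birkhoff_sum_def[abs_def]
  by (intro borel_measurable_sum measurable_compose[OF measurable_shift_iterate]) auto

lemma integrable_bounded:
  fixes F :: "(nat \<Rightarrow> nat) \<Rightarrow> real"
  assumes "F \<in> borel_measurable \<mu>" "\<And>m. m \<in> symbolic_space M \<Longrightarrow> \<bar>F m\<bar> \<le> b"
  shows "integrable \<mu> F"
  using assms by (intro mu.integrable_const_bound[where B=b] AE_I2) (auto simp: space_mu)

lemma birkhoff_sum_bound:
  assumes "\<And>m. m \<in> symbolic_space M \<Longrightarrow> \<bar>F m\<bar> \<le> b" "m \<in> symbolic_space M"
  shows "\<bar>birkhoff_sum F n m\<bar> \<le> real n * b"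
proof -
  have "\<bar>birkhoff_sum F n m\<bar> \<le> (\<Sum>k<n. \<bar>F (\<lambda>j. m (j + k))\<bar>)"
    unfolding birkhoff_sum_def by (rule sum_abs)
  also have "\<dots> \<le> (\<Sum>k<n. b)"
    using assms by (intro sum_mono) (auto simp: symbolic_space_shift_iterate)
  finally show ?thesis by simp
qed

lemma integral_birkhoff_sum:
  fixes F :: "(nat \<Rightarrow> nat) \<Rightarrow> real"
  assumes F[measurable]: "F \<in> borel_measurable \<mu>" and b: "\<And>m. m \<in> symbolic_space M \<Longrightarrow> \<bar>F m\<bar> \<le> b"
  shows "(\<integral>m. birkhoff_sum F n m \<partial>\<mu>) = real n * (\<integral>m. F m \<partial>\<mu>)"
proof (induction n)
  case (Suc n)
  have "integrable \<mu> (birkhoff_sum F n)"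
    using birkhoff_sum_bound[OF b] by (intro integrable_bounded) auto
  then have "integrable \<mu> (\<lambda>m. birkhoff_sum F n (shift m))"
    using integrable_distr[of shift \<mu> \<mu> "birkhoff_sum F n"] by (simp add: distr_shift)
  then show ?case
    using integrable_bounded[OF F b] Suc
    by (simp add: birkhoff_sum_Suc integral_shift algebra_simps)
qed simp

section \<open>Ergodicity\<close>

lemma emeasure_box_inter_invariant:
  assumes Z: "Z \<in> sets \<mu>"
    and inv: "\<And>m. m \<in> symbolic_space M \<Longrightarrow> m \<in> Z \<longleftrightarrow> shift m \<in> Z"
  shows "emeasure \<mu> {m \<in> Z. \<forall>j<n. m j \<in> A j} = (\<Prod>j<n. emeasure digit_measure (A j \<inter> {1..M})) * emeasure \<mu> Z"
proof (induction n arbitrary: A)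
  case 0
  show ?case by simp
next
  case (Suc n)
  note [measurable] = Z
  have ZS: "Z \<subseteq> symbolic_space M"
    using sets.sets_into_space[OF Z] by (simp add: space_mu)
  have Zeq: "{m \<in> Z. \<forall>j<Suc n. m j \<in> A j} = {m \<in> space \<mu>. m \<in> Z \<and> (\<forall>j<Suc n. m j \<in> A j)}"
    using ZS by (auto simp: space_mu)
  have meas: "{m \<in> Z. \<forall>j<Suc n. m j \<in> A j} \<in> sets \<mu>"
    unfolding Zeq by measurable
  have "emeasure \<mu> {m \<in> Z. \<forall>j<Suc n. m j \<in> A j} = (\<Sum>i\<in>{1..M}. ennreal (q i) *
      emeasure \<mu> {m \<in> symbolic_space M. case_nat i m \<in> {m \<in> Z. \<forall>j<Suc n. m j \<in> A j}})"
    by (rule emeasure_first_digit[OF meas])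
  also have "\<dots> = (\<Sum>i\<in>{1..M}. ennreal (q i) * (indicator (A 0) i * emeasure \<mu> {m \<in> Z. \<forall>j<n. m j \<in> A (Suc j)}))"
  proof (rule sum.cong[OF refl])
    fix i assume i: "i \<in> {1..M}"
    have "{m \<in> symbolic_space M. case_nat i m \<in> {m \<in> Z. \<forall>j<Suc n. m j \<in> A j}}
        = (if i \<in> A 0 then {m \<in> Z. \<forall>j<n. m j \<in> A (Suc j)} else {})"
      using ZS inv[OF symbolic_space_case_nat[OF i]]
      by (auto simp: less_Suc_eq_0_disj)
    then show "ennreal (q i) * emeasure \<mu> {m \<in> symbolic_space M. case_nat i m \<in> {m \<in> Z. \<forall>j<Suc n. m j \<in> A j}}
      = ennreal (q i) * (indicator (A 0) i * emeasure \<mu> {m \<in> Z. \<forall>j<n. m j \<in> A (Suc j)})"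
      by simp
  qed
  also have "\<dots> = (\<Sum>i\<in>{1..M}. ennreal (q i) * indicator (A 0) i) * emeasure \<mu> {m \<in> Z. \<forall>j<n. m j \<in> A (Suc j)}"
    unfolding sum_distrib_right mult.assoc ..
  also have "(\<Sum>i\<in>{1..M}. ennreal (q i) * indicator (A 0) i) = emeasure digit_measure (A 0 \<inter> {1..M})"
    by (subst emeasure_point_measure_finite)
      (auto intro!: sum.mono_neutral_cong_right simp: indicator_def)
  finally show ?case
    unfolding Suc.IH by (subst prod.lessThan_Suc_shift) (simp only: mult.assoc comp_def)
qed

text \<open>An invariant set is independent of every cylinder; conditioning on it therefore does not change
  \<open>\<mu>\<close>.\<close>

lemma invariant_set_zero_one:
  assumes Z: "Z \<in> sets \<mu>"
    and inv: "\<And>m. m \<in> symbolic_space M \<Longrightarrow> m \<in> Z \<longleftrightarrow> shift m \<in> Z"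
  shows "mu.prob Z = 0 \<or> mu.prob Z = 1"
proof (cases "emeasure \<mu> Z = 0")
  case True
  then show ?thesis by (simp add: measure_def)
next
  case False
  have fin: "emeasure \<mu> Z \<noteq> \<infinity>" by simp
  have ZS: "Z \<subseteq> symbolic_space M"
    using sets.sets_into_space[OF Z] by (simp add: space_mu)
  have "uniform_measure \<mu> Z = digits.S"
  proof (rule digits.PiM_eq)
    show "sets (uniform_measure \<mu> Z) = sets digits.S"
      by (simp add: mu_eq)
    fix J and F :: "nat \<Rightarrow> nat set"
    assume J: "finite J" "J \<subseteq> UNIV" and F: "\<And>j. j \<in> J \<Longrightarrow> F j \<in> sets digit_measure"
    let ?X = "prod_emb UNIV (\<lambda>_. digit_measure) J (Pi\<^sub>E J F)"
    have X: "?X \<in> sets digits.S"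
      using J F by (intro sets_PiM_I) auto
    obtain n where n: "J \<subseteq> {..<n}"
      using J(1) finite_nat_iff_bounded by blast
    define A where "A j = (if j \<in> J then F j else {1..M})" for j
    have "Z \<inter> ?X = {m \<in> Z. \<forall>j<n. m j \<in> A j}"
      using ZS n by (auto simp: prod_emb_def A_def space_point_measure symbolic_space_def PiE_def extensional_def Pi_def)
    then have "emeasure (uniform_measure \<mu> Z) ?X
        = (\<Prod>j<n. emeasure digit_measure (A j \<inter> {1..M})) * emeasure \<mu> Z / emeasure \<mu> Z"
      using Z X emeasure_box_inter_invariant[OF Z inv, of n A]
      by (subst emeasure_uniform_measure) (simp_all add: mu_eq)
    also have "\<dots> = (\<Prod>j<n. emeasure digit_measure (A j \<inter> {1..M}))"
      using False fin by (simp add: ennreal_mult_divide_eq)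
    also have "\<dots> = (\<Prod>j\<in>J. emeasure digit_measure (F j))"
    proof (rule prod.mono_neutral_cong_right)
      show "\<forall>i\<in>{..<n} - J. emeasure digit_measure (A i \<inter> {1..M}) = 1"
        using prob_space.emeasure_space_1[OF prob_space_digit_measure]
        by (simp add: A_def space_point_measure)
      show "emeasure digit_measure (A j \<inter> {1..M}) = emeasure digit_measure (F j)" if "j \<in> J" for j
        using F[OF that] that by (auto simp: A_def sets_point_measure Int_absorb2)
    qed (use n in auto)
    finally show "emeasure (uniform_measure \<mu> Z) ?X = (\<Prod>j\<in>J. emeasure digit_measure (F j))" .
  qed
  then have "emeasure \<mu> Z = emeasure (uniform_measure \<mu> Z) Z"
    by (simp add: mu_eq)
  also have "\<dots> = 1"
    using Z False fin by (simp add: ennreal_divide_self less_top[symmetric])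
  finally show ?thesis by (simp add: measure_def)
qed

text \<open>If the Birkhoff sums stayed below \<open>\<kappa> n + j\<close>, integrating would contradict the mean of
  \<open>F\<close>; allowing the additive constant \<open>j\<close> makes the exceptional set invariant, so that ergodicity
  applies.\<close>

lemma birkhoff_sum_exceeds:
  fixes F :: "(nat \<Rightarrow> nat) \<Rightarrow> real"
  assumes F[measurable]: "F \<in> borel_measurable \<mu>" and b: "\<And>m. m \<in> symbolic_space M \<Longrightarrow> \<bar>F m\<bar> \<le> b"
    and \<kappa>: "\<kappa> < (\<integral>m. F m \<partial>\<mu>)"
  shows "AE m in \<mu>. \<forall>j::nat. \<exists>n. birkhoff_sum F n m > \<kappa> * real n + real j"
proof -
  define Z where "Z j = {m \<in> space \<mu>. \<forall>n. birkhoff_sum F n m \<le> \<kappa> * real n + real j}" for j :: nat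
  have Zj[measurable]: "Z j \<in> sets \<mu>" for j
    unfolding Z_def by measurable
  have "mono Z"
    unfolding Z_def by (intro monoI) (auto intro: order_trans)
  define W where "W = (\<Union>j. Z j)"
  have W[measurable]: "W \<in> sets \<mu>" unfolding W_def by auto
  have inv: "m \<in> W \<longleftrightarrow> shift m \<in> W" if m: "m \<in> symbolic_space M" for m
  proof
    obtain d where d: "\<bar>F m\<bar> + \<bar>\<kappa>\<bar> \<le> real d" using real_arch_simple by blast
    have step: "birkhoff_sum F (Suc n) m = F m + birkhoff_sum F n (shift m)" for n
      by (rule birkhoff_sum_Suc)
    {
      assume "m \<in> W"
      then obtain j where j: "\<And>n. birkhoff_sum F n m \<le> \<kappa> * real n + real j"
        by (auto simp: W_def Z_def)
      have "birkhoff_sum F n (shift m) \<le> \<kappa> * real n + real (j + d)" for n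
        using j[of "Suc n"] step[of n] d by (auto simp: algebra_simps)
      then show "shift m \<in> W"
        using symbolic_space_shift[OF m] unfolding W_def Z_def space_mu by blast
    }
    {
      assume "shift m \<in> W"
      then obtain j where j: "\<And>n. birkhoff_sum F n (shift m) \<le> \<kappa> * real n + real j"
        by (auto simp: W_def Z_def)
      have "birkhoff_sum F n m \<le> \<kappa> * real n + real (j + d)" for n
      proof (cases n)
        case (Suc k)
        then show ?thesis using j[of k] step[of k] d by (auto simp: algebra_simps)
      qed simp
      then show "m \<in> W"
        using m unfolding W_def Z_def space_mu by blast
    }
  qed
  have "mu.prob W \<noteq> 1"
  proof
    assume W1: "mu.prob W = 1"
    define e where "e = (\<integral>m. F m \<partial>\<mu>) - \<kappa>"
    have e: "0 < e" using \<kappa> by (simp add: e_def)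
    have b0: "0 \<le> b"
    proof -
      obtain m where "m \<in> symbolic_space M"
        using mu.not_empty by (auto simp: space_mu)
      with b[of m] show ?thesis by linarith
    qed
    have "(\<lambda>j. mu.prob (Z j)) \<longlonglongrightarrow> mu.prob W"
      unfolding W_def using \<open>mono Z\<close> by (intro mu.finite_Lim_measure_incseq) auto
    then have "(\<lambda>j. (b + \<bar>\<kappa>\<bar>) * (1 - mu.prob (Z j))) \<longlonglongrightarrow> (b + \<bar>\<kappa>\<bar>) * (1 - 1)"
      unfolding W1 by (intro tendsto_intros)
    then have "eventually (\<lambda>j. (b + \<bar>\<kappa>\<bar>) * (1 - mu.prob (Z j)) < e) sequentially"
      using e by (intro order_tendstoD) auto
    then obtain j where j: "(b + \<bar>\<kappa>\<bar>) * (1 - mu.prob (Z j)) < e"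
      by (auto simp: eventually_sequentially)
    have bnd: "real n * (\<integral>m. F m \<partial>\<mu>) \<le> \<kappa> * real n + real j + real n * (b + \<bar>\<kappa>\<bar>) * (1 - mu.prob (Z j))" for n
    proof -
      have intF: "integrable \<mu> (birkhoff_sum F n)"
        using birkhoff_sum_bound[OF b] by (intro integrable_bounded) auto
      have "real n * (\<integral>m. F m \<partial>\<mu>) = (\<integral>m. birkhoff_sum F n m \<partial>\<mu>)"
        using integral_birkhoff_sum[OF F b] by simp
      also have "\<dots> \<le> (\<integral>m. \<kappa> * real n + real j + real n * (b + \<bar>\<kappa>\<bar>) * indicator (space \<mu> - Z j) m \<partial>\<mu>)"
      proof (rule integral_mono[OF intF])
        show "integrable \<mu> (\<lambda>m. \<kappa> * real n + real j + real n * (b + \<bar>\<kappa>\<bar>) * indicator (space \<mu> - Z j) m)"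
          by (intro Bochner_Integration.integrable_add integrable_const integrable_mult_right
              integrable_real_indicator mu.emeasure_finite) (auto simp: less_top[symmetric])
        fix m assume m: "m \<in> space \<mu>"
        show "birkhoff_sum F n m \<le> \<kappa> * real n + real j + real n * (b + \<bar>\<kappa>\<bar>) * indicator (space \<mu> - Z j) m"
        proof (cases "m \<in> Z j")
          case False
          have "birkhoff_sum F n m \<le> real n * b"
            using birkhoff_sum_bound[where F=F and b=b and m=m and n=n, OF b] m by (simp add: space_mu abs_le_iff)
          moreover have "0 \<le> \<kappa> * real n + real n * \<bar>\<kappa>\<bar>"
            using mult_right_mono[of "- \<kappa>" "\<bar>\<kappa>\<bar>" "real n", OF abs_ge_minus_self] by (simp add: mult.commute)
          ultimately show ?thesis using False m by (simp add: algebra_simps)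
        qed (auto simp: Z_def)
      qed
      also have "\<dots> = \<kappa> * real n + real j + real n * (b + \<bar>\<kappa>\<bar>) * mu.prob (space \<mu> - Z j)"
        by (subst Bochner_Integration.integral_add)
          (auto intro!: integrable_mult_right integrable_real_indicator simp: mu.prob_space less_top[symmetric])
      also have "mu.prob (space \<mu> - Z j) = 1 - mu.prob (Z j)"
        by (rule mu.prob_compl) simp
      finally show ?thesis .
    qed
    define d where "d = e - (b + \<bar>\<kappa>\<bar>) * (1 - mu.prob (Z j))"
    have "0 < d" using j by (simp add: d_def)
    then obtain n :: nat where "real j < real n * d"
      using reals_Archimedean3 by blast
    moreover have "real n * d \<le> real j"
      using bnd[of n] by (simp add: d_def e_def algebra_simps)
    ultimately show False by simp
  qed
  then have "mu.prob W = 0"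
    using invariant_set_zero_one[OF W inv] by blast
  then have "W \<in> null_sets \<mu>"
    by (simp add: mu.emeasure_eq_measure null_setsI)
  then have "AE m in \<mu>. m \<notin> W"
    by (rule AE_not_in)
  then show ?thesis
    using AE_space by eventually_elim (auto simp: W_def Z_def not_le)
qed

end

section \<open>The maximal ergodic theorem\<close>

text \<open>The maximum of the Birkhoff sums of order at most \<open>n\<close>, in the recursive form that exhibits its
  increment along the shift.\<close>

primrec maximal_sum :: "((nat \<Rightarrow> 'a) \<Rightarrow> real) \<Rightarrow> nat \<Rightarrow> (nat \<Rightarrow> 'a) \<Rightarrow> real" where
  "maximal_sum F 0 m = 0"
| "maximal_sum F (Suc n) m = max 0 (F m + maximal_sum F n (shift m))"

lemma maximal_sum_nonneg: "0 \<le> maximal_sum F n m"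
  by (cases n) auto

lemma maximal_sum_mono_Suc: "maximal_sum F n m \<le> maximal_sum F (Suc n) m"
proof (induction n arbitrary: m)
  case (Suc n)
  from Suc[of "shift m"] show ?case by (simp add: max.coboundedI2)
qed simp

lemma birkhoff_sum_le_maximal_sum: "birkhoff_sum F n m \<le> maximal_sum F n m"
proof (induction n arbitrary: m)
  case (Suc n)
  from Suc[of "shift m"] show ?case by (simp add: birkhoff_sum_Suc max.coboundedI2)
qed simp

context bernoulli_ifs begin

text \<open>Garsia's argument: where the maximal sum is positive, \<open>F\<close> dominates the increment of the
  maximal sum along the shift, and the mean of that increment is nonnegative.\<close>

lemma maximal_ergodic:
  fixes F :: "(nat \<Rightarrow> nat) \<Rightarrow> real"
  assumes F[measurable]: "F \<in> borel_measurable \<mu>" and b: "\<And>m. m \<in> symbolic_space M \<Longrightarrow> \<bar>F m\<bar> \<le> b"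
    and neg: "(\<integral>m. F m \<partial>\<mu>) < 0"
  shows "0 < mu.prob {m \<in> space \<mu>. \<forall>n. birkhoff_sum F n m \<le> 0}"
proof (rule ccontr)
  assume null: "\<not> ?thesis"
  define G where "G = {m \<in> space \<mu>. \<forall>n. birkhoff_sum F n m \<le> 0}"
  have G0: "mu.prob G = 0"
    using null unfolding G_def[symmetric] zero_less_measure_iff by simp
  have Gm[measurable]: "G \<in> sets \<mu>" unfolding G_def by measurable
  have Mm[measurable]: "maximal_sum F n \<in> borel_measurable \<mu>" for n
  proof (induction n)
    case (Suc n)
    note [measurable] = Suc
    show ?case by simp measurable
  qed simp
  have b0: "0 \<le> b"
  proof -
    obtain m where "m \<in> symbolic_space M"
      using mu.not_empty by (auto simp: space_mu)
    with b[of m] show ?thesis by linarith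
  qed
  have Mb: "maximal_sum F n m \<le> real n * b" if "m \<in> symbolic_space M" for n m
    using that
  proof (induction n arbitrary: m)
    case (Suc n)
    have "F m + maximal_sum F n (shift m) \<le> b + real n * b"
      using Suc.IH[OF symbolic_space_shift[OF Suc.prems]] b[OF Suc.prems] by linarith
    then show ?case using b0 by (simp add: algebra_simps)
  qed simp
  have Mi: "integrable \<mu> (maximal_sum F n)" for n
    using Mb maximal_sum_nonneg[of F n] by (intro integrable_bounded[where b="real n * b"]) (auto simp: abs_of_nonneg)
  have Mis: "integrable \<mu> (\<lambda>m. maximal_sum F n (shift m))" for n
    using integrable_distr[OF measurable_shift, of "maximal_sum F n"] Mi[of n] unfolding distr_shift by simp
  define A where "A n = {m \<in> space \<mu>. 0 < maximal_sum F (Suc n) m}" for n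
  have Am[measurable]: "A n \<in> sets \<mu>" for n unfolding A_def by measurable
  have inc: "incseq A"
    unfolding A_def using maximal_sum_mono_Suc by (intro incseq_SucI) (blast intro: less_le_trans)
  have key: "- (b * (1 - mu.prob (A n))) \<le> (\<integral>m. F m \<partial>\<mu>)" for n
  proof -
    have "0 \<le> (\<integral>m. maximal_sum F (Suc n) m - maximal_sum F n m \<partial>\<mu>)"
      by (intro integral_nonneg_AE AE_I2) (simp add: maximal_sum_mono_Suc del: maximal_sum.simps)
    also have "\<dots> = (\<integral>m. maximal_sum F (Suc n) m \<partial>\<mu>) - (\<integral>m. maximal_sum F n m \<partial>\<mu>)"
      by (rule Bochner_Integration.integral_diff[OF Mi Mi])
    also have "(\<integral>m. maximal_sum F n m \<partial>\<mu>) = (\<integral>m. maximal_sum F n (shift m) \<partial>\<mu>)"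
      by (rule integral_shift[symmetric]) measurable
    also have "(\<integral>m. maximal_sum F (Suc n) m \<partial>\<mu>) - (\<integral>m. maximal_sum F n (shift m) \<partial>\<mu>)
        = (\<integral>m. maximal_sum F (Suc n) m - maximal_sum F n (shift m) \<partial>\<mu>)"
      by (rule Bochner_Integration.integral_diff[OF Mi Mis, symmetric])
    also have "\<dots> \<le> (\<integral>m. F m + b * indicator (space \<mu> - A n) m \<partial>\<mu>)"
    proof (rule integral_mono)
      show "integrable \<mu> (\<lambda>m. maximal_sum F (Suc n) m - maximal_sum F n (shift m))"
        by (rule Bochner_Integration.integrable_diff[OF Mi Mis])
      show "integrable \<mu> (\<lambda>m. F m + b * indicator (space \<mu> - A n) m)"
        using integrable_bounded[OF F b]
        by (intro Bochner_Integration.integrable_add integrable_mult_right integrable_real_indicator)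
          (auto simp: less_top[symmetric])
      fix m assume m: "m \<in> space \<mu>"
      show "maximal_sum F (Suc n) m - maximal_sum F n (shift m) \<le> F m + b * indicator (space \<mu> - A n) m"
      proof (cases "m \<in> A n")
        case True
        then show ?thesis by (auto simp: A_def)
      next
        case False
        then have "maximal_sum F (Suc n) m \<le> 0" using m by (simp add: A_def not_less del: maximal_sum.simps)
        moreover have "0 \<le> F m + b" using b[of m] m by (auto simp: space_mu)
        ultimately show ?thesis
          using False m maximal_sum_nonneg[of F n "shift m"] by (simp del: maximal_sum.simps)
      qed
    qed
    also have "\<dots> = (\<integral>m. F m \<partial>\<mu>) + b * mu.prob (space \<mu> - A n)"
      using integrable_bounded[OF F b]
      by (subst Bochner_Integration.integral_add)
        (auto intro!: integrable_mult_right integrable_real_indicator simp: less_top[symmetric])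
    also have "mu.prob (space \<mu> - A n) = 1 - mu.prob (A n)"
      by (rule mu.prob_compl) simp
    finally show ?thesis by simp
  qed
  have "space \<mu> - G \<subseteq> (\<Union>n. A n)"
  proof
    fix m assume m: "m \<in> space \<mu> - G"
    then obtain n where "0 < birkhoff_sum F n m" by (auto simp: G_def not_le)
    then have "0 < maximal_sum F (Suc n) m"
      using birkhoff_sum_le_maximal_sum[of F n m] maximal_sum_mono_Suc[of F n m] by linarith
    then show "m \<in> (\<Union>n. A n)" using m by (auto simp: A_def)
  qed
  then have "mu.prob (space \<mu> - G) \<le> mu.prob (\<Union>n. A n)"
    by (intro mu.finite_measure_mono) auto
  then have "mu.prob (\<Union>n. A n) = 1"
    using mu.prob_compl[OF Gm] G0 mu.prob_le_1[of "\<Union>n. A n"] by linarith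
  then have "(\<lambda>n. mu.prob (A n)) \<longlonglongrightarrow> 1"
    using mu.finite_Lim_measure_incseq[OF _ inc] Am by (simp add: image_subset_iff)
  then have "(\<lambda>n. - (b * (1 - mu.prob (A n)))) \<longlonglongrightarrow> - (b * (1 - 1))"
    by (intro tendsto_intros)
  then have "- (b * (1 - 1)) \<le> (\<integral>m. F m \<partial>\<mu>)"
    by (rule LIMSEQ_le_const2) (use key in blast)
  with neg show False by simp
qed

end

section \<open>Cylinders and the coding map\<close>

definition word_prod :: "(nat \<Rightarrow> real) \<Rightarrow> (nat \<Rightarrow> nat) \<Rightarrow> nat \<Rightarrow> real" where
  "word_prod f w n = (\<Prod>k<n. f (w k))"

lemma word_prod_0 [simp]: "word_prod f w 0 = 1"
  by (simp add: word_prod_def)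

lemma word_prod_Suc: "word_prod f w (Suc n) = word_prod f w n * f (w n)"
  by (simp add: word_prod_def)

lemma word_prod_add: "word_prod f w (n + k) = word_prod f w n * word_prod f (\<lambda>j. w (j + n)) k"
  by (induction k) (simp_all add: word_prod_Suc add.commute)

lemma word_prod_cong: "(\<And>k. k < n \<Longrightarrow> v k = w k) \<Longrightarrow> word_prod f v n = word_prod f w n"
  by (simp add: word_prod_def)

lemma ln_word_prod:
  assumes "\<And>k. k < n \<Longrightarrow> 0 < f (w k)"
  shows "ln (word_prod f w n) = (\<Sum>k<n. ln (f (w k)))"
  unfolding word_prod_def using assms by (intro ln_prod) (auto dest: less_imp_neq[OF assms, symmetric])

lemma word_prod_pos:
  assumes "\<And>k. k < n \<Longrightarrow> 0 < f (w k)"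
  shows "0 < word_prod f w n"
  unfolding word_prod_def using assms by (intro prod_pos) auto

definition cylinder :: "nat \<Rightarrow> (nat \<Rightarrow> nat) \<Rightarrow> nat \<Rightarrow> (nat \<Rightarrow> nat) set" where
  "cylinder M w n = {m \<in> symbolic_space M. \<forall>k<n. m k = w k}"

lemma cylinder_map_affine:
  "cylinder_map r u m n x = word_prod r m n * x + cylinder_map r u m n 0"
proof (induction n arbitrary: x)
  case (Suc n)
  show ?case
    using Suc[of "ifs_map r u (m n) x"] Suc[of "ifs_map r u (m n) 0"]
    by (simp add: word_prod_Suc ifs_map_def algebra_simps)
qed simp

lemma cylinder_map_0: "cylinder_map r u m n 0 = (\<Sum>k<n. word_prod r m k * u (m k))"
proof (induction n)
  case (Suc n)
  then show ?case
    using cylinder_map_affine[of r u m n "ifs_map r u (m n) 0"] by (simp add: ifs_map_def)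
qed simp

lemma cylinder_map_cong:
  assumes "\<And>k. k < n \<Longrightarrow> v k = w k"
  shows "cylinder_map r u v n 0 = cylinder_map r u w n 0"
  unfolding cylinder_map_0 using assms
  by (intro sum.cong arg_cong2[where f="(*)"] word_prod_cong) auto

context bernoulli_ifs begin

lemma integral_digit:
  fixes g :: "nat \<Rightarrow> real"
  shows "(\<integral>m. g (m 0) \<partial>\<mu>) = (\<Sum>i\<in>{1..M}. q i * g i)"
proof -
  have meas: "(\<lambda>m. m 0) \<in> measurable digits.S digit_measure"
    by (rule measurable_component_singleton) simp
  have "(\<integral>m. g (m 0) \<partial>\<mu>) = (\<integral>i. g i \<partial>(distr digits.S digit_measure (\<lambda>m. m 0)))"
    unfolding mu_eq using meas by (subst integral_distr) auto
  also have "distr digits.S digit_measure (\<lambda>m. m 0) = digit_measure"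
    using digits.PiM_component[of 0] by simp
  also have "(\<integral>i. g i \<partial>digit_measure) = (\<Sum>i\<in>{1..M}. q i * g i)"
    using q_pos by (subst lebesgue_integral_point_measure_finite) (auto simp: less_imp_le)
  finally show ?thesis .
qed

lemma cylinder_sets [measurable]: "cylinder M w n \<in> sets \<mu>"
proof -
  have "cylinder M w n = {m \<in> space \<mu>. \<forall>k<n. m k = w k}"
    by (simp add: cylinder_def space_mu)
  then show ?thesis by simp
qed

lemma word_prod_q_nonneg: "(\<And>k. k < n \<Longrightarrow> w k \<in> {1..M}) \<Longrightarrow> 0 \<le> word_prod q w n"
  using word_prod_pos[of n q w] q_pos by (simp add: less_imp_le)

lemma word_prod_r_pos: "(\<And>k. k < n \<Longrightarrow> w k \<in> {1..M}) \<Longrightarrow> 0 < word_prod r w n"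
  using word_prod_pos[of n r w] ratio by simp

lemma emeasure_cylinder:
  assumes w: "\<And>k. k < n \<Longrightarrow> w k \<in> {1..M}"
  shows "emeasure \<mu> (cylinder M w n) = ennreal (word_prod q w n)"
proof -
  have "emeasure \<mu> {m \<in> space \<mu>. \<forall>j<n. m j \<in> {w j}}
      = (\<Prod>j<n. emeasure digit_measure ({w j} \<inter> {1..M})) * emeasure \<mu> (space \<mu>)"
    by (rule emeasure_box_inter_invariant[OF sets.top]) (auto simp: space_mu symbolic_space_shift)
  also have "\<dots> = (\<Prod>j<n. ennreal (q (w j)))"
  proof -
    have "emeasure digit_measure ({w j} \<inter> {1..M}) = ennreal (q (w j))" if "j < n" for j
    proof -
      have "{w j} \<inter> {1..M} = {w j}" using w[OF that] by auto
      then show ?thesis using w[OF that] by (simp add: emeasure_point_measure_finite)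
    qed
    then show ?thesis by (simp add: mu.emeasure_space_1)
  qed
  also have "\<dots> = ennreal (word_prod q w n)"
    unfolding word_prod_def using w q_pos by (intro prod_ennreal) (auto simp: less_imp_le)
  finally show ?thesis by (simp add: cylinder_def space_mu)
qed

definition max_ratio :: real where "max_ratio = Max (r ` {1..M})"
definition max_shift :: real where "max_shift = Max ((\<lambda>i. \<bar>u i\<bar>) ` {1..M})"
definition radius :: real where "radius = max_shift / (1 - max_ratio)"

lemma max_ratio: "0 < max_ratio" "max_ratio < 1" "i \<in> {1..M} \<Longrightarrow> r i \<le> max_ratio"
proof -
  have "max_ratio \<in> r ` {1..M}"
    unfolding max_ratio_def using M_pos by (intro Max_in) auto
  then show "0 < max_ratio" "max_ratio < 1" using ratio by auto
qed (simp add: max_ratio_def)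

lemma abs_u_le: "i \<in> {1..M} \<Longrightarrow> \<bar>u i\<bar> \<le> max_shift"
  by (simp add: max_shift_def)

lemma word_prod_r_le:
  assumes "\<And>k. k < n \<Longrightarrow> w k \<in> {1..M}"
  shows "word_prod r w n \<le> max_ratio ^ n"
proof -
  have "word_prod r w n \<le> (\<Prod>k<n. max_ratio)"
    unfolding word_prod_def using assms ratio max_ratio(3) by (intro prod_mono) (auto simp: less_imp_le)
  then show ?thesis by simp
qed

lemma coding_series:
  assumes m: "m \<in> symbolic_space M"
  shows "summable (\<lambda>k. word_prod r m k * u (m k))"
    and "coding_map r u m = (\<Sum>k. word_prod r m k * u (m k))"
    and "\<bar>coding_map r u m\<bar> \<le> radius"
proof -
  have bnd: "norm (word_prod r m k * u (m k)) \<le> max_ratio ^ k * max_shift" for k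
    using word_prod_r_le[of k m] word_prod_r_pos[of k m] symbolic_space_digit[OF m] abs_u_le[of "m k"]
    by (auto simp: abs_mult intro!: mult_mono)
  have sums: "(\<lambda>k. max_ratio ^ k * max_shift) sums (1 / (1 - max_ratio) * max_shift)"
    using max_ratio by (intro sums_mult2 geometric_sums) auto
  show S: "summable (\<lambda>k. word_prod r m k * u (m k))"
    using bnd by (intro summable_comparison_test'[OF sums_summable[OF sums], of 0])
  from summable_LIMSEQ[OF S]
  show eq: "coding_map r u m = (\<Sum>k. word_prod r m k * u (m k))"
    unfolding coding_map_def cylinder_map_0 by (rule limI)
  have "norm (\<Sum>k. word_prod r m k * u (m k)) \<le> (\<Sum>k. max_ratio ^ k * max_shift)"
    using bnd sums_summable[OF sums] by (rule norm_suminf_le)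
  then show "\<bar>coding_map r u m\<bar> \<le> radius"
    unfolding sums_unique[OF sums, symmetric] eq by (simp add: radius_def)
qed

lemma coding_map_split:
  assumes m: "m \<in> symbolic_space M"
  shows "coding_map r u m = word_prod r m n * coding_map r u (\<lambda>j. m (j + n)) + cylinder_map r u m n 0"
proof -
  have m': "(\<lambda>j. m (j + n)) \<in> symbolic_space M"
    by (rule symbolic_space_shift_iterate[OF m])
  have "coding_map r u m = (\<Sum>k. word_prod r m (k + n) * u (m (k + n))) + (\<Sum>k<n. word_prod r m k * u (m k))"
    unfolding coding_series(2)[OF m] by (rule suminf_split_initial_segment[OF coding_series(1)[OF m]])
  also have "(\<Sum>k. word_prod r m (k + n) * u (m (k + n)))
      = (\<Sum>k. word_prod r m n * (word_prod r (\<lambda>j. m (j + n)) k * u (m (k + n))))"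
  proof (rule suminf_cong)
    fix k
    show "word_prod r m (k + n) * u (m (k + n)) = word_prod r m n * (word_prod r (\<lambda>j. m (j + n)) k * u (m (k + n)))"
      unfolding add.commute[of k n] word_prod_add by (rule mult.assoc)
  qed
  also have "\<dots> = word_prod r m n * coding_map r u (\<lambda>j. m (j + n))"
    unfolding coding_series(2)[OF m'] by (rule suminf_mult[OF coding_series(1)[OF m']])
  finally show ?thesis by (simp add: cylinder_map_0)
qed

lemma coding_map_shift:
  assumes m: "m \<in> symbolic_space M"
  shows "coding_map r u m = r (m 0) * coding_map r u (shift m) + u (m 0)"
  using coding_map_split[OF m, of 1] by (simp add: word_prod_Suc shift_def ifs_map_def)

lemma coding_map_measurable [measurable]: "coding_map r u \<in> borel_measurable \<mu>"
  unfolding coding_map_def[abs_def] cylinder_map_0 word_prod_def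
  by (intro borel_measurable_lim_metric borel_measurable_sum borel_measurable_times borel_measurable_prod
      measurable_compose[OF measurable_digit]) auto

abbreviation \<nu> :: "real measure" where
  "\<nu> \<equiv> self_similar_measure M r u q"

lemma sets_nu [simp, measurable_cong]: "sets \<nu> = sets borel" and space_nu [simp]: "space \<nu> = UNIV"
  by (simp_all add: self_similar_measure_def)

sublocale nu: prob_space \<nu>
  unfolding self_similar_measure_def by (rule mu.prob_space_distr) measurable

lemma emeasure_nu: "B \<in> sets borel \<Longrightarrow> emeasure \<nu> B = emeasure \<mu> {m \<in> symbolic_space M. coding_map r u m \<in> B}"
  unfolding self_similar_measure_def
  by (subst emeasure_distr) (auto simp: space_mu intro!: arg_cong2[where f=emeasure])

definition cylinder_interval :: "(nat \<Rightarrow> nat) \<Rightarrow> nat \<Rightarrow> real set" where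
  "cylinder_interval w n = cball (cylinder_map r u w n 0) (radius * word_prod r w n)"

lemma coding_map_in_interval:
  assumes m: "m \<in> cylinder M w n"
  shows "coding_map r u m \<in> cylinder_interval w n"
proof -
  have mS: "m \<in> symbolic_space M" and eq: "\<And>k. k < n \<Longrightarrow> m k = w k"
    using m by (auto simp: cylinder_def)
  have cm: "cylinder_map r u m n 0 = cylinder_map r u w n 0"
    by (rule cylinder_map_cong) (rule eq)
  have wp: "word_prod r m n = word_prod r w n"
    by (rule word_prod_cong) (rule eq)
  have "coding_map r u m - cylinder_map r u w n 0 = word_prod r w n * coding_map r u (\<lambda>j. m (j + n))"
    using coding_map_split[OF mS, of n] unfolding cm wp by simp
  moreover have "0 < word_prod r w n"
    using word_prod_r_pos[of n m] symbolic_space_digit[OF mS] wp by simp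
  moreover have "\<bar>coding_map r u (\<lambda>j. m (j + n))\<bar> \<le> radius"
    by (rule coding_series(3)[OF symbolic_space_shift_iterate[OF mS]])
  ultimately show ?thesis
    by (simp add: cylinder_interval_def dist_real_def abs_minus_commute abs_mult mult.commute)
qed

end

section \<open>Dimension bounds from heavy balls\<close>

lemma hausdorff_premeasure_le:
  fixes V :: "'i \<Rightarrow> 'a::metric_space set"
  assumes e: "bij (e :: nat \<Rightarrow> 'i)" and A: "A \<subseteq> (\<Union>i. V i)"
    and V: "\<And>i. bounded (V i)" "\<And>i. diameter (V i) \<le> \<delta>"
  shows "hausdorff_premeasure s \<delta> A \<le> (\<integral>\<^sup>+i. hausdorff_weight s (V i) \<partial>count_space UNIV)"
proof -
  have "(\<Union>n. V (e n)) = (\<Union>i. V i)"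
    using bij_is_surj[OF e] by (metis image_image)
  then have "V \<circ> e \<in> delta_covers \<delta> A"
    using A V by (simp add: delta_covers_def)
  then have "hausdorff_premeasure s \<delta> A \<le> (\<Sum>n. hausdorff_weight s ((V \<circ> e) n))"
    unfolding hausdorff_premeasure_def by (rule INF_lower)
  also have "\<dots> = (\<integral>\<^sup>+n. hausdorff_weight s (V (e n)) \<partial>count_space UNIV)"
    by (simp add: nn_integral_count_space_nat)
  also have "\<dots> = (\<integral>\<^sup>+i. hausdorff_weight s (V i) \<partial>count_space UNIV)"
    by (rule nn_integral_bij_count_space[OF e])
  finally show ?thesis .
qed

definition grid_cell :: "nat \<Rightarrow> int \<Rightarrow> real set" where
  "grid_cell l j = {of_int j / 2 ^ l .. (of_int j + 1) / 2 ^ l}"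

lemma grid_cell_bounded: "bounded (grid_cell l j)"
  by (simp add: grid_cell_def)

lemma grid_cell_diameter: "diameter (grid_cell l j) \<le> 1 / 2 ^ l"
proof (rule diameter_le)
  fix x y assume "x \<in> grid_cell l j" "y \<in> grid_cell l j"
  then show "norm (x - y) \<le> 1 / 2 ^ l"
    by (auto simp: grid_cell_def add_divide_distrib abs_le_iff)
qed simp

lemma grid_cell_covers: "x \<in> grid_cell l \<lfloor>x * 2 ^ l\<rfloor>"
  unfolding grid_cell_def atLeastAtMost_iff
  by (auto simp: divide_le_eq le_divide_eq intro: real_of_int_floor_add_one_ge)

lemma hausdorff_weight_grid_cell:
  assumes "0 < t"
  shows "hausdorff_weight t (grid_cell l j) \<le> ennreal (2 powr (- (t * real l)))"
proof -
  have "diameter (grid_cell l j) powr t \<le> (1 / 2 ^ l) powr t"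
    using assms by (intro powr_mono2 grid_cell_diameter diameter_ge_0 grid_cell_bounded) auto
  also have "(1 / 2 ^ l :: real) powr t = 2 powr (- (t * real l))"
    by (simp add: powr_divide powr_realpow[symmetric] powr_powr powr_minus_divide mult.commute)
  finally show ?thesis
    using assms by (auto simp: hausdorff_weight_def intro: ennreal_leI)
qed

text \<open>A cell that contains the centre of a heavy ball has an enlargement of mass at least \<open>c\<close>, and a point
  lies in at most \<open>2 D + 2\<close> of these enlargements.\<close>

lemma card_heavy_cells:
  fixes N :: "real measure" and c :: real and l D :: nat
  assumes "prob_space N" and [measurable_cong]: "sets N = sets borel"
  defines "H \<equiv> {j. \<exists>x\<in>grid_cell l j. c \<le> measure N (cball x (real D / 2 ^ l))}"
  assumes c: "0 < c"
  shows "finite H \<and> real (card H) \<le> (2 * real D + 2) / c"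
proof -
  interpret prob_space N by fact
  define K where "K j = {(of_int j - real D) / 2 ^ l .. (of_int j + 1 + real D) / 2 ^ l}" for j :: int
  have K[measurable]: "K j \<in> sets N" for j
    unfolding K_def by measurable
  have bound: "real (card G) \<le> (2 * real D + 2) / c" if G: "G \<subseteq> H" "finite G" for G
  proof -
    have heavy: "c \<le> measure N (K j)" if "j \<in> G" for j
    proof -
      from that G obtain x where x: "x \<in> grid_cell l j" "c \<le> measure N (cball x (real D / 2 ^ l))"
        by (auto simp: H_def)
      have "cball x (real D / 2 ^ l) \<subseteq> K j"
      proof
        fix y assume "y \<in> cball x (real D / 2 ^ l)"
        then have "x - real D / 2 ^ l \<le> y" "y \<le> x + real D / 2 ^ l"
          by (auto simp: dist_real_def abs_le_iff)
        with x(1) show "y \<in> K j"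
          by (auto simp: K_def grid_cell_def add_divide_distrib diff_divide_distrib)
      qed
      then have "measure N (cball x (real D / 2 ^ l)) \<le> measure N (K j)"
        by (intro finite_measure_mono) auto
      with x(2) show ?thesis by simp
    qed
    have overlap: "(\<Sum>j\<in>G. indicator (K j) x) \<le> 2 * real D + 2" for x :: real
    proof -
      let ?y = "x * 2 ^ l"
      have sub: "{j\<in>G. x \<in> K j} \<subseteq> {\<lceil>?y\<rceil> - int D - 1 .. \<lfloor>?y\<rfloor> + int D}"
      proof
        fix j assume "j \<in> {j\<in>G. x \<in> K j}"
        then have "of_int j - real D \<le> ?y" "?y \<le> of_int j + 1 + real D"
          by (auto simp: K_def field_simps)
        then show "j \<in> {\<lceil>?y\<rceil> - int D - 1 .. \<lfloor>?y\<rfloor> + int D}"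
          by (simp, linarith)
      qed
      have "card {j\<in>G. x \<in> K j} \<le> card {\<lceil>?y\<rceil> - int D - 1 .. \<lfloor>?y\<rfloor> + int D}"
        using sub by (intro card_mono) auto
      also have "\<dots> \<le> 2 * D + 2"
      proof -
        have "\<lfloor>?y\<rfloor> \<le> \<lceil>?y\<rceil>" by (rule floor_le_ceiling)
        then have "nat (\<lfloor>?y\<rfloor> + int D - (\<lceil>?y\<rceil> - int D - 1) + 1) \<le> 2 * D + 2" by linarith
        then show ?thesis by (simp only: card_atLeastAtMost_int)
      qed
      finally have "real (card {j\<in>G. x \<in> K j}) \<le> 2 * real D + 2" by linarith
      moreover have "(\<Sum>j\<in>G. indicator (K j) x) = real (card {j\<in>G. x \<in> K j})"
        using G(2) by (simp add: indicator_def Collect_conj_eq Int_commute)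
      ultimately show ?thesis by simp
    qed
    have "real (card G) * c \<le> (\<Sum>j\<in>G. measure N (K j))"
      using sum_mono[of G "\<lambda>_. c" "\<lambda>j. measure N (K j)"] heavy by simp
    also have "\<dots> = (\<integral>x. (\<Sum>j\<in>G. indicator (K j) x) \<partial>N)"
      by (subst Bochner_Integration.integral_sum)
        (auto intro!: integrable_real_indicator simp: less_top[symmetric])
    also have "\<dots> \<le> (\<integral>x. 2 * real D + 2 \<partial>N)"
      using overlap by (intro integral_mono Bochner_Integration.integrable_sum)
        (auto intro!: integrable_real_indicator simp: less_top[symmetric])
    also have "\<dots> = 2 * real D + 2"
      by (simp add: prob_space)
    finally show ?thesis using c by (simp add: field_simps)
  qed
  have "finite H \<and> card H \<le> nat \<lfloor>(2 * real D + 2) / c\<rfloor>"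
    by (rule finite_if_finite_subsets_card_bdd) (use bound in \<open>simp add: le_nat_floor\<close>)
  then show ?thesis
    using bound by blast
qed

text \<open>At scale \<open>2\<^bsup>-l\<^esup>\<close> a constant times \<open>2\<^bsup>sl\<^esup>\<close> cells contain all centres of heavy balls, so that
  for \<open>t > s\<close> the covers by fine cells have \<open>t\<close>-sums bounded by tails of a geometric series.\<close>

lemma hausdorff_measure_limsup_heavy:
  fixes N :: "real measure" and D :: nat
  assumes N: "prob_space N" "sets N = sets borel" and s: "0 \<le> s" "s < t"
  shows "hausdorff_measure t
    {x. \<exists>\<^sub>\<infinity>l. 2 powr (- (s * real l)) \<le> measure N (cball x (real D / 2 ^ l))} = 0"
    (is "hausdorff_measure t ?A = 0")
proof -
  define H where "H l = {j. \<exists>x\<in>grid_cell l j. 2 powr (- (s * real l)) \<le> measure N (cball x (real D / 2 ^ l))}" for l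
  have H: "finite (H l)" "real (card (H l)) \<le> (2 * real D + 2) * 2 powr (s * real l)" for l
    using card_heavy_cells[OF N, of "2 powr (- (s * real l))" l D]
    by (auto simp: H_def powr_minus divide_inverse)
  define \<theta> where "\<theta> = 2 powr (- (t - s))"
  have \<theta>: "0 < \<theta>" "\<theta> < 1"
    using s powr_less_mono[of "- (t - s)" 0 2] by (auto simp: \<theta>_def)
  define C where "C = 2 * real D + 2"
  have pre: "hausdorff_premeasure t \<delta> ?A \<le> ennreal (C / (1 - \<theta>) * \<theta> ^ L)" if L: "1 / 2 ^ L \<le> \<delta>" for L \<delta>
  proof -
    \<comment> \<open>Indexing by \<open>(k, j)\<close> with scale \<open>k + L\<close> bounds the diameter of every cell of the cover by \<open>\<delta>\<close>.\<close>
    define V where "V p = (if snd p \<in> H (fst p + L) then grid_cell (fst p + L) (snd p) else {})" for p :: "nat \<times> int"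
    define e where "e = (\<lambda>n. map_prod id int_decode (prod_decode n))"
    have "bij (map_prod id int_decode :: nat \<times> nat \<Rightarrow> nat \<times> int)"
      using map_prod_surj[OF surj_id surj_int_decode] prod.inj_map[OF inj_on_id inj_int_decode]
      by (intro bijI) auto
    then have e: "bij e"
      unfolding e_def using bij_comp[OF bij_prod_decode] by (simp add: comp_def)
    have cover: "?A \<subseteq> (\<Union>p. V p)"
    proof
      fix x assume "x \<in> ?A"
      then have "\<forall>k. \<exists>l\<ge>k. 2 powr (- (s * real l)) \<le> measure N (cball x (real D / 2 ^ l))"
        by (simp add: INFM_nat_le)
      then obtain l where l: "L \<le> l" "2 powr (- (s * real l)) \<le> measure N (cball x (real D / 2 ^ l))"
        by blast
      then have "\<lfloor>x * 2 ^ l\<rfloor> \<in> H l"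
        using grid_cell_covers[of x l] by (auto simp: H_def)
      then have "x \<in> V (l - L, \<lfloor>x * 2 ^ l\<rfloor>)"
        using grid_cell_covers[of x l] l(1) by (simp add: V_def)
      then show "x \<in> (\<Union>p. V p)" by blast
    qed
    have "0 \<le> \<delta>" using L by (rule order_trans[rotated]) simp
    have diam: "diameter (V p) \<le> \<delta>" for p
    proof -
      have "diameter (grid_cell (fst p + L) (snd p)) \<le> 1 / 2 ^ (fst p + L)"
        by (rule grid_cell_diameter)
      also have "\<dots> \<le> 1 / 2 ^ L"
        by (intro divide_left_mono power_increasing) auto
      finally show ?thesis using L \<open>0 \<le> \<delta>\<close> by (simp add: V_def)
    qed
    have "hausdorff_premeasure t \<delta> ?A \<le> (\<integral>\<^sup>+p. hausdorff_weight t (V p) \<partial>count_space UNIV)"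
      using e cover by (rule hausdorff_premeasure_le) (use diam in \<open>auto simp: V_def grid_cell_bounded\<close>)
    also have "\<dots> = (\<integral>\<^sup>+k. (\<integral>\<^sup>+j. hausdorff_weight t (V (k, j)) \<partial>count_space UNIV) \<partial>count_space UNIV)"
      by (rule nn_integral_fst_count_space[symmetric])
    also have "\<dots> \<le> (\<integral>\<^sup>+k. ennreal (C * \<theta> ^ (k + L)) \<partial>count_space UNIV)"
    proof (rule nn_integral_mono)
      fix k
      have "(\<integral>\<^sup>+j. hausdorff_weight t (V (k, j)) \<partial>count_space UNIV)
          \<le> (\<integral>\<^sup>+j. ennreal (2 powr (- (t * real (k + L)))) * indicator (H (k + L)) j \<partial>count_space UNIV)"
        using s hausdorff_weight_grid_cell[of t "k + L"]
        by (intro nn_integral_mono) (auto simp: V_def indicator_def hausdorff_weight_def[of _ "{}"])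
      also have "\<dots> = ennreal (2 powr (- (t * real (k + L)))) * ennreal (real (card (H (k + L))))"
        using H(1)[of "k + L"] by (simp add: nn_integral_cmult_indicator ennreal_of_nat_eq_real_of_nat)
      also have "\<dots> = ennreal (2 powr (- (t * real (k + L))) * real (card (H (k + L))))"
        by (rule ennreal_mult[symmetric]) auto
      also have "\<dots> \<le> ennreal (2 powr (- (t * real (k + L))) * (C * 2 powr (s * real (k + L))))"
        using H(2)[of "k + L"] by (intro ennreal_leI mult_left_mono) (auto simp: C_def)
      also have "2 powr (- (t * real (k + L))) * (C * 2 powr (s * real (k + L))) = C * 2 powr (- (t - s) * real (k + L))"
        by (simp add: powr_add[symmetric] algebra_simps)
      also have "\<dots> = C * \<theta> ^ (k + L)"
        unfolding \<theta>_def powr_powr[symmetric] by (subst powr_realpow) auto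
      finally show "(\<integral>\<^sup>+j. hausdorff_weight t (V (k, j)) \<partial>count_space UNIV) \<le> ennreal (C * \<theta> ^ (k + L))" .
    qed
    also have "\<dots> = (\<Sum>k. ennreal (C * \<theta> ^ (k + L)))"
      by (rule nn_integral_count_space_nat)
    also have "\<dots> = ennreal (C / (1 - \<theta>) * \<theta> ^ L)"
    proof (rule suminf_ennreal_eq)
      have "(\<lambda>k. C * \<theta> ^ L * \<theta> ^ k) sums (C * \<theta> ^ L * (1 / (1 - \<theta>)))"
        using \<theta> by (intro sums_mult geometric_sums) auto
      then show "(\<lambda>k. C * \<theta> ^ (k + L)) sums (C / (1 - \<theta>) * \<theta> ^ L)"
        by (simp add: power_add mult_ac)
    qed (use \<theta> in \<open>auto simp: C_def\<close>)
    finally show ?thesis .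
  qed
  have "hausdorff_premeasure t \<delta> ?A = 0" if \<delta>: "0 < \<delta>" for \<delta>
  proof -
    have "(\<lambda>L. ennreal (C / (1 - \<theta>) * \<theta> ^ L)) \<longlonglongrightarrow> ennreal (C / (1 - \<theta>) * 0)"
      using \<theta> by (intro tendsto_ennrealI tendsto_mult_left LIMSEQ_realpow_zero) auto
    moreover obtain L0 where L0: "(1 / 2) ^ L0 < \<delta>"
      using real_arch_pow_inv[OF \<delta>, of "1 / 2"] by auto
    have "hausdorff_premeasure t \<delta> ?A \<le> ennreal (C / (1 - \<theta>) * \<theta> ^ L)" if "L0 \<le> L" for L
    proof (rule pre)
      have "(1 / 2 :: real) ^ L \<le> (1 / 2) ^ L0"
        using that by (intro power_decreasing) auto
      then show "1 / 2 ^ L \<le> \<delta>" using L0 by (simp add: power_one_over)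
    qed
    ultimately have "hausdorff_premeasure t \<delta> ?A \<le> ennreal (C / (1 - \<theta>) * 0)"
      by (intro LIMSEQ_le_const) auto
    then show ?thesis by simp
  qed
  then show ?thesis
    unfolding hausdorff_measure_def by (simp add: SUP_eq_const)
qed

section \<open>Words and visits to an ambiguous set\<close>

definition words :: "nat \<Rightarrow> nat \<Rightarrow> (nat \<Rightarrow> nat) set" where
  "words M n = PiE {..<n} (\<lambda>_. {1..M})"

lemma finite_words [simp]: "finite (words M n)"
  by (simp add: words_def finite_PiE)

lemma words_digit: "w \<in> words M n \<Longrightarrow> k < n \<Longrightarrow> w k \<in> {1..M}"
  by (auto simp: words_def PiE_def Pi_def)

lemma words_eqI:
  assumes "v \<in> words M n" "w \<in> words M n" "\<And>k. k < n \<Longrightarrow> v k = w k"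
  shows "v = w"
  using assms unfolding words_def by (intro PiE_ext) auto

lemma restrict_in_words: "m \<in> symbolic_space M \<Longrightarrow> restrict m {..<n} \<in> words M n"
  by (auto simp: words_def symbolic_space_def)

lemma mem_cylinder_restrict: "m \<in> symbolic_space M \<Longrightarrow> m \<in> cylinder M (restrict m {..<n}) n"
  by (simp add: cylinder_def)

lemma disjoint_cylinders: "disjoint_family_on (\<lambda>w. cylinder M w n) (words M n)"
  unfolding disjoint_family_on_def
proof (intro ballI impI)
  fix v w assume vw: "v \<in> words M n" "w \<in> words M n" "v \<noteq> w"
  then obtain k where "k < n" "v k \<noteq> w k"
    using words_eqI[OF vw(1,2)] by blast
  then show "cylinder M v n \<inter> cylinder M w n = {}"
    by (auto simp: cylinder_def)
qed

lemma dyadic_scale_exists: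
  fixes x :: real
  assumes "0 < x" "x \<le> 1"
  obtains l :: nat where "(1 / 2) ^ Suc l < x" "x \<le> (1 / 2) ^ l"
proof -
  obtain n where n: "(1 / 2 :: real) ^ n < x"
    using real_arch_pow_inv[OF assms(1), of "1 / 2"] by auto
  define k where "k = (LEAST n. (1 / 2 :: real) ^ n < x)"
  have k: "(1 / 2) ^ k < x" unfolding k_def using n by (rule LeastI)
  then obtain l where l: "k = Suc l" using assms(2) by (cases k) auto
  then have "\<not> (1 / 2) ^ l < x"
    using not_less_Least[of l "\<lambda>n. (1 / 2 :: real) ^ n < x"] unfolding k_def by simp
  with k l that show ?thesis by (auto simp: not_less)
qed

context bernoulli_ifs begin

definition entropy :: real where "entropy = - (\<Sum>i\<in>{1..M}. q i * ln (q i))"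
definition lyapunov :: real where "lyapunov = - (\<Sum>i\<in>{1..M}. q i * ln (r i))"

lemma lyapunov_pos: "0 < lyapunov"
proof -
  have "(\<Sum>i\<in>{1..M}. q i * ln (r i)) < 0"
  proof -
    have "(\<Sum>i\<in>{1..M}. q i * ln (r i)) < (\<Sum>i\<in>{1..M}. 0)"
    proof (rule sum_strict_mono)
      show "q i * ln (r i) < 0" if "i \<in> {1..M}" for i
        using q_pos[OF that] ratio[OF that] by (intro mult_pos_neg) auto
    qed (use M_pos in auto)
    then show ?thesis by simp
  qed
  then show ?thesis by (simp add: lyapunov_def)
qed

lemma entropy_nonneg: "0 \<le> entropy"
proof -
  have "(\<Sum>i\<in>{1..M}. q i * ln (q i)) \<le> 0"
    using q_pos q_le_1 by (intro sum_nonpos mult_nonneg_nonpos) (auto simp: less_imp_le)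
  then show ?thesis by (simp add: entropy_def)
qed

lemma sets_Collect_mu:
  "{m \<in> space \<mu>. P m} \<in> sets \<mu> \<Longrightarrow> {m \<in> symbolic_space M. P m} \<in> sets \<mu>"
  by (simp add: space_mu)

lemma coding_preimage_sets:
  assumes [measurable]: "B \<in> sets borel"
  shows "{m \<in> symbolic_space M. coding_map r u m \<in> B} \<in> sets \<mu>"
  by (rule sets_Collect_mu) measurable

lemma emeasure_prefix:
  assumes i: "i \<in> {1..M}" and A: "A \<in> sets \<mu>"
  shows "emeasure \<mu> {m \<in> symbolic_space M. m 0 = i \<and> shift m \<in> A} = ennreal (q i) * emeasure \<mu> A"
proof -
  note [measurable] = A
  have S: "{m \<in> symbolic_space M. m 0 = i \<and> shift m \<in> A} \<in> sets \<mu>"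
    by (rule sets_Collect_mu) measurable
  have AS: "A \<subseteq> symbolic_space M"
    using sets.sets_into_space[OF A] by (simp add: space_mu)
  have "emeasure \<mu> {m \<in> symbolic_space M. m 0 = i \<and> shift m \<in> A} = (\<Sum>j\<in>{1..M}. if j = i then ennreal (q i) * emeasure \<mu> A else 0)"
    unfolding emeasure_first_digit[OF S]
  proof (rule sum.cong[OF refl])
    fix j assume j: "j \<in> {1..M}"
    have "{m \<in> symbolic_space M. case_nat j m \<in> {m \<in> symbolic_space M. m 0 = i \<and> shift m \<in> A}} = (if j = i then A else {})"
      using AS symbolic_space_case_nat[OF j] by auto
    then show "ennreal (q j) * emeasure \<mu> {m \<in> symbolic_space M. case_nat j m \<in> {m \<in> symbolic_space M. m 0 = i \<and> shift m \<in> A}}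
      = (if j = i then ennreal (q i) * emeasure \<mu> A else 0)"
      by simp
  qed
  also have "\<dots> = ennreal (q i) * emeasure \<mu> A"
    using i by simp
  finally show ?thesis .
qed

lemma emeasure_nu_ball_measurable:
  "(\<lambda>x. emeasure \<nu> (cball x \<rho>)) \<in> borel_measurable borel"
proof -
  have "{p :: real \<times> real. dist (fst p) (snd p) \<le> \<rho>} \<in> sets borel"
    by (intro borel_closed closed_Collect_le continuous_intros)
  then have "{p :: real \<times> real. dist (fst p) (snd p) \<le> \<rho>} \<in> sets (borel \<Otimes>\<^sub>M \<nu>)"
    unfolding sets_pair_measure_cong[OF refl sets_nu] borel_prod .
  from nu.measurable_emeasure_Pair[OF this]
  show ?thesis
    by (simp add: vimage_def cball_def)
qed

text \<open>Over points of \<open>E\<close>, the conditional probability of the first symbol \<open>i\<close> given the coded point is at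
  most \<open>a\<close>; the form with subsets of \<open>E\<close> avoids choosing a version of that probability.  The value
  \<open>a = 1\<close> is admitted so that one upper bound serves systems with and without ambiguity.\<close>

definition ambiguous :: "nat \<Rightarrow> real set \<Rightarrow> real \<Rightarrow> bool" where
  "ambiguous i E a \<longleftrightarrow> E \<in> sets borel \<and> 0 < a \<and> a \<le> 1 \<and>
    (\<forall>B\<in>sets borel. B \<subseteq> E \<longrightarrow>
      emeasure \<mu> {m \<in> symbolic_space M. m 0 = i \<and> coding_map r u m \<in> B} \<le> ennreal a * emeasure \<nu> B)"

definition visit :: "nat \<Rightarrow> real set \<Rightarrow> (nat \<Rightarrow> nat) set" where
  "visit i E = {m \<in> symbolic_space M. m 0 = i \<and> coding_map r u m \<in> E}"

lemma visit_sets [measurable]: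
  assumes [measurable]: "E \<in> sets borel"
  shows "visit i E \<in> sets \<mu>"
  unfolding visit_def by (rule sets_Collect_mu) measurable

text \<open>Each visit of the orbit to the ambiguous set costs a factor \<open>a\<close>, because the conditional
  probability of a word given the coded point is a product along the orbit.\<close>

lemma emeasure_cylinder_visits:
  fixes \<tau> :: real
  assumes amb: "ambiguous i E a" and B: "B \<in> sets borel"
  shows "emeasure \<mu> {m \<in> cylinder M w n. coding_map r u m \<in> B \<and>
      birkhoff_sum (\<lambda>m. ln a * indicator (visit i E) m) n m \<le> \<tau>} \<le> ennreal (exp \<tau>) * emeasure \<nu> B"
  using B
proof (induction n arbitrary: w B \<tau>)
  case 0
  show ?case
  proof (cases "0 \<le> \<tau>")
    case True
    have "emeasure \<mu> {m \<in> symbolic_space M. coding_map r u m \<in> B} = 1 * emeasure \<nu> B"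
      using 0 by (simp add: emeasure_nu)
    also have "\<dots> \<le> ennreal (exp \<tau>) * emeasure \<nu> B"
      using True by (intro mult_right_mono) auto
    finally show ?thesis using True by (simp add: cylinder_def)
  qed (simp add: cylinder_def)
next
  case (Suc n)
  note [measurable] = Suc.prems
  have E[measurable]: "E \<in> sets borel" and a: "0 < a" "a \<le> 1" using amb by (auto simp: ambiguous_def)
  define G where "G = (\<lambda>m. ln a * indicator (visit i E) m)"
  have G[measurable]: "G \<in> borel_measurable \<mu>" unfolding G_def by measurable
  show ?case
  proof (cases "w 0 \<in> {1..M}")
    case False
    have "cylinder M w (Suc n) = {}"
    proof (rule equals0I)
      fix m assume "m \<in> cylinder M w (Suc n)"
      then have "m 0 = w 0" "m \<in> symbolic_space M" by (auto simp: cylinder_def)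
      with False symbolic_space_digit[of m M 0] show False by simp
    qed
    then show ?thesis by simp
  next
    case w0: True
    define h where "h = (\<lambda>x. r (w 0) * x + u (w 0))"
    have h[measurable]: "h \<in> borel_measurable borel" unfolding h_def by measurable
    have step: "emeasure \<mu> {m \<in> cylinder M w (Suc n). coding_map r u m \<in> C \<and> birkhoff_sum G n (shift m) \<le> \<sigma>}
        \<le> ennreal (exp \<sigma>) * emeasure \<mu> {m \<in> symbolic_space M. m 0 = w 0 \<and> coding_map r u m \<in> C}"
      if C[measurable]: "C \<in> sets borel" for C \<sigma>
    proof -
      have hC[measurable]: "h -` C \<in> sets borel"
        using measurable_sets[OF h C] by simp
      define A where "A = {m \<in> cylinder M (shift w) n. coding_map r u m \<in> h -` C \<and> birkhoff_sum G n m \<le> \<sigma>}"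
      have Aeq: "A = {m \<in> symbolic_space M. m \<in> cylinder M (shift w) n \<and> coding_map r u m \<in> h -` C \<and> birkhoff_sum G n m \<le> \<sigma>}"
        by (auto simp: A_def cylinder_def)
      have A: "A \<in> sets \<mu>"
        unfolding Aeq by (rule sets_Collect_mu) measurable
      define A' where "A' = {m \<in> symbolic_space M. coding_map r u m \<in> h -` C}"
      have A': "A' \<in> sets \<mu>"
        unfolding A'_def by (rule sets_Collect_mu) measurable
      have code: "coding_map r u m \<in> C \<longleftrightarrow> coding_map r u (shift m) \<in> h -` C"
        if "m \<in> symbolic_space M" "m 0 = w 0" for m
        using coding_map_shift[OF that(1)] that(2) by (simp add: h_def)
      have "{m \<in> cylinder M w (Suc n). coding_map r u m \<in> C \<and> birkhoff_sum G n (shift m) \<le> \<sigma>}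
          = {m \<in> symbolic_space M. m 0 = w 0 \<and> shift m \<in> A}"
        using code symbolic_space_shift
        by (auto simp: cylinder_def A_def less_Suc_eq_0_disj shift_def)
      then have "emeasure \<mu> {m \<in> cylinder M w (Suc n). coding_map r u m \<in> C \<and> birkhoff_sum G n (shift m) \<le> \<sigma>}
          = ennreal (q (w 0)) * emeasure \<mu> A"
        using emeasure_prefix[OF w0 A] by simp
      also have "\<dots> \<le> ennreal (q (w 0)) * (ennreal (exp \<sigma>) * emeasure \<nu> (h -` C))"
        unfolding A_def G_def using hC by (intro mult_left_mono Suc.IH) auto
      also have "emeasure \<nu> (h -` C) = emeasure \<mu> A'"
        using hC by (simp add: emeasure_nu A'_def)
      also have "ennreal (q (w 0)) * (ennreal (exp \<sigma>) * emeasure \<mu> A') = ennreal (exp \<sigma>) * (ennreal (q (w 0)) * emeasure \<mu> A')"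
        by (rule mult.left_commute)
      also have "ennreal (q (w 0)) * emeasure \<mu> A' = emeasure \<mu> {m \<in> symbolic_space M. m 0 = w 0 \<and> shift m \<in> A'}"
        by (rule emeasure_prefix[OF w0 A', symmetric])
      also have "{m \<in> symbolic_space M. m 0 = w 0 \<and> shift m \<in> A'} = {m \<in> symbolic_space M. m 0 = w 0 \<and> coding_map r u m \<in> C}"
        using code symbolic_space_shift by (auto simp: A'_def)
      finally show ?thesis .
    qed
    \<comment> \<open>The part of \<open>B\<close> over which the first step is a visit; it contributes \<open>ln a\<close> to
      the sum, which leaves \<open>\<tau> - ln a\<close> for the remaining steps.\<close>
    define C where "C = (if w 0 = i then B \<inter> E else {})"
    have C[measurable]: "C \<in> sets borel" unfolding C_def by auto
    let ?X = "{m \<in> cylinder M w (Suc n). coding_map r u m \<in> C \<and> birkhoff_sum G n (shift m) \<le> \<tau> - ln a}"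
    let ?Y = "{m \<in> cylinder M w (Suc n). coding_map r u m \<in> B - C \<and> birkhoff_sum G n (shift m) \<le> \<tau>}"
    have "?X = {m \<in> space \<mu>. m \<in> cylinder M w (Suc n) \<and> coding_map r u m \<in> C \<and> birkhoff_sum G n (shift m) \<le> \<tau> - ln a}"
      by (auto simp: cylinder_def space_mu)
    then have X: "?X \<in> sets \<mu>" by simp
    have "?Y = {m \<in> space \<mu>. m \<in> cylinder M w (Suc n) \<and> coding_map r u m \<in> B - C \<and> birkhoff_sum G n (shift m) \<le> \<tau>}"
      by (auto simp: cylinder_def space_mu)
    then have Y: "?Y \<in> sets \<mu>" by simp
    have "{m \<in> cylinder M w (Suc n). coding_map r u m \<in> B \<and> birkhoff_sum G (Suc n) m \<le> \<tau>} \<subseteq> ?X \<union> ?Y"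
      by (auto simp: cylinder_def birkhoff_sum_Suc G_def visit_def C_def indicator_def split: if_splits)
    then have "emeasure \<mu> {m \<in> cylinder M w (Suc n). coding_map r u m \<in> B \<and> birkhoff_sum G (Suc n) m \<le> \<tau>}
        \<le> emeasure \<mu> ?X + emeasure \<mu> ?Y"
      using X Y by (intro order_trans[OF emeasure_mono emeasure_subadditive]) auto
    also have "emeasure \<mu> ?X \<le> ennreal (exp \<tau>) * emeasure \<nu> C"
    proof (cases "w 0 = i")
      case True
      have "emeasure \<mu> ?X \<le> ennreal (exp (\<tau> - ln a)) * emeasure \<mu> {m \<in> symbolic_space M. m 0 = w 0 \<and> coding_map r u m \<in> C}"
        by (rule step[OF C])
      also have "\<dots> \<le> ennreal (exp (\<tau> - ln a)) * (ennreal a * emeasure \<nu> C)"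
        using amb C True by (intro mult_left_mono) (auto simp: ambiguous_def C_def)
      also have "\<dots> = ennreal (exp \<tau>) * emeasure \<nu> C"
        using a by (simp add: mult.assoc[symmetric] ennreal_mult[symmetric] exp_diff)
      finally show ?thesis .
    qed (simp add: C_def)
    also have "emeasure \<mu> ?Y \<le> ennreal (exp \<tau>) * emeasure \<nu> (B - C)"
    proof -
      have "emeasure \<mu> ?Y \<le> ennreal (exp \<tau>) * emeasure \<mu> {m \<in> symbolic_space M. m 0 = w 0 \<and> coding_map r u m \<in> B - C}"
        by (rule step) measurable
      also have "\<dots> \<le> ennreal (exp \<tau>) * emeasure \<mu> {m \<in> symbolic_space M. coding_map r u m \<in> B - C}"
        by (intro mult_left_mono emeasure_mono sets_Collect_mu) (auto, measurable)
      finally show ?thesis by (simp add: emeasure_nu)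
    qed
    also have "ennreal (exp \<tau>) * emeasure \<nu> C + ennreal (exp \<tau>) * emeasure \<nu> (B - C) = ennreal (exp \<tau>) * emeasure \<nu> B"
    proof -
      have "emeasure \<nu> C + emeasure \<nu> (B - C) = emeasure \<nu> (C \<union> (B - C))"
        by (rule plus_emeasure) auto
      also have "C \<union> (B - C) = B" by (auto simp: C_def)
      finally show ?thesis by (simp add: distrib_left[symmetric])
    qed
    finally show ?thesis
      unfolding G_def by (simp add: add_mono)
  qed
qed

text \<open>Among words of comparable contraction whose interval contains \<open>x\<close>, the cylinders are disjoint
  and are all coded into one ball around \<open>x\<close>.\<close>

lemma sum_cylinder_interval_le:
  fixes l D n :: nat
  assumes W: "W \<subseteq> words M n" "\<And>w. w \<in> W \<Longrightarrow> word_prod r w n \<le> (1 / 2) ^ l"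
    and D: "2 * radius \<le> real D"
  shows "(\<Sum>w\<in>W. ennreal (word_prod q w n) * indicator (cylinder_interval w n) x)
    \<le> emeasure \<nu> (cball x (real D / 2 ^ l))"
proof -
  define V where "V = {w\<in>W. x \<in> cylinder_interval w n}"
  have VW: "V \<subseteq> W" by (auto simp: V_def)
  have finW: "finite W" using finite_subset[OF W(1)] by simp
  have finV: "finite V" using VW finW finite_subset by blast
  have "(\<Sum>w\<in>W. ennreal (word_prod q w n) * indicator (cylinder_interval w n) x) = (\<Sum>w\<in>V. ennreal (word_prod q w n))"
    using finW by (intro sum.mono_neutral_cong_right) (auto simp: V_def)
  also have "\<dots> = (\<Sum>w\<in>V. emeasure \<mu> (cylinder M w n))"
    using VW W(1) words_digit by (intro sum.cong refl emeasure_cylinder[symmetric]) blast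
  also have "\<dots> = emeasure \<mu> (\<Union>w\<in>V. cylinder M w n)"
    using finV VW W(1) disjoint_family_on_mono[OF _ disjoint_cylinders]
    by (intro sum_emeasure) auto
  also have "\<dots> \<le> emeasure \<mu> {m \<in> symbolic_space M. coding_map r u m \<in> cball x (real D / 2 ^ l)}"
  proof (intro emeasure_mono coding_preimage_sets)
    show "(\<Union>w\<in>V. cylinder M w n) \<subseteq> {m \<in> symbolic_space M. coding_map r u m \<in> cball x (real D / 2 ^ l)}"
    proof
      fix m assume "m \<in> (\<Union>w\<in>V. cylinder M w n)"
      then obtain w where w: "w \<in> W" "x \<in> cylinder_interval w n" "m \<in> cylinder M w n"
        by (auto simp: V_def)
      have "dist x (coding_map r u m) \<le> 2 * radius * word_prod r w n"
        using w(2) coding_map_in_interval[OF w(3)] unfolding cylinder_interval_def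
        by (simp add: dist_real_def)
      also have "\<dots> \<le> real D * (1 / 2) ^ l"
      proof (intro mult_mono D)
        show "word_prod r w n \<le> (1 / 2) ^ l" by (rule W(2)[OF w(1)])
        show "0 \<le> word_prod r w n"
          using word_prod_r_pos[of n w] words_digit W(1) w(1) by (meson less_imp_le subsetD)
      qed simp
      finally show "m \<in> {m \<in> symbolic_space M. coding_map r u m \<in> cball x (real D / 2 ^ l)}"
        using w(3) by (simp add: cylinder_def power_one_over)
    qed
  qed simp
  also have "\<dots> = emeasure \<nu> (cball x (real D / 2 ^ l))"
    by (rule emeasure_nu[symmetric]) simp
  finally show ?thesis .
qed

end

section \<open>The upper bound for the dimension\<close>

context bernoulli_ifs begin

lemma birkhoff_sum_add: "birkhoff_sum (\<lambda>m. F m + G m) n m = birkhoff_sum F n m + birkhoff_sum G n m"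
  by (simp add: birkhoff_sum_def sum.distrib)

lemma birkhoff_sum_digit: "birkhoff_sum (\<lambda>m. g (m 0)) n m = (\<Sum>k<n. g (m k))"
  by (simp add: birkhoff_sum_def)

lemma ln_word_prod_q: "m \<in> symbolic_space M \<Longrightarrow> ln (word_prod q m n) = (\<Sum>k<n. ln (q (m k)))"
  and ln_word_prod_r: "m \<in> symbolic_space M \<Longrightarrow> ln (word_prod r m n) = (\<Sum>k<n. ln (r (m k)))"
  using symbolic_space_digit q_pos ratio by (intro ln_word_prod; blast)+

definition potential_bound :: "real \<Rightarrow> real" where
  "potential_bound s = Max ((\<lambda>i. \<bar>ln (q i) - s * ln (r i)\<bar>) ` {1..M})"

lemma potential_bound: "i \<in> {1..M} \<Longrightarrow> \<bar>ln (q i) - s * ln (r i)\<bar> \<le> potential_bound s"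
  by (simp add: potential_bound_def)

lemma integral_potential: "(\<integral>m. ln (q (m 0)) - s * ln (r (m 0)) \<partial>\<mu>) = s * lyapunov - entropy"
proof -
  have "(\<integral>m. ln (q (m 0)) - s * ln (r (m 0)) \<partial>\<mu>) = (\<Sum>i\<in>{1..M}. q i * (ln (q i) - s * ln (r i)))"
    by (rule integral_digit)
  also have "\<dots> = s * lyapunov - entropy"
    by (simp add: entropy_def lyapunov_def algebra_simps sum_subtractf sum_distrib_left)
  finally show ?thesis .
qed

text \<open>Birkhoff sums of \<open>ln q - s ln r - ln a \<cdot> 1\<close>, the last indicator being that of a visit,
  exceed every rate below their mean infinitely often.  In terms of the word \<open>w\<close> of length \<open>n\<close> this reads
  \<open>a\<^bsup>visits\<^esup> r\<^sub>w\<^bsup>s\<^esup> \<le> q\<^sub>w e\<^bsup>-\<kappa>n\<^esup>\<close>.\<close>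

lemma cheap_words_infinitely_often:
  assumes amb: "ambiguous i E a" and \<kappa>: "0 \<le> \<kappa>"
    and mean: "\<kappa> < s * lyapunov - entropy - ln a * mu.prob (visit i E)"
  shows "AE m in \<mu>. \<forall>N. \<exists>n\<ge>N. birkhoff_sum (\<lambda>m. ln a * indicator (visit i E) m) n m
    \<le> ln (word_prod q m n) - s * ln (word_prod r m n) - \<kappa> * real n"
proof -
  have E[measurable]: "E \<in> sets borel" and a: "0 < a" "a \<le> 1" using amb by (auto simp: ambiguous_def)
  define G where "G = (\<lambda>m. ln a * indicator (visit i E) m)"
  have G[measurable]: "G \<in> borel_measurable \<mu>" unfolding G_def by measurable
  define g where "g i = ln (q i) - s * ln (r i)" for i
  have gm[measurable]: "(\<lambda>m. g (m 0)) \<in> borel_measurable \<mu>"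
    by (rule measurable_compose[OF measurable_digit]) simp
  define F where "F m = g (m 0) + - G m" for m
  have F[measurable]: "F \<in> borel_measurable \<mu>" unfolding F_def by measurable
  define b where "b = potential_bound s + \<bar>ln a\<bar>"
  have gb: "\<bar>g (m 0)\<bar> \<le> potential_bound s" if "m \<in> symbolic_space M" for m
    unfolding g_def by (rule potential_bound[OF symbolic_space_digit[OF that]])
  have Gb: "\<bar>G m\<bar> \<le> \<bar>ln a\<bar>" for m
    by (auto simp: G_def indicator_def)
  have b: "\<bar>F m\<bar> \<le> b" if "m \<in> symbolic_space M" for m
    using gb[OF that] Gb[of m] unfolding F_def b_def by linarith
  have "(\<integral>m. F m \<partial>\<mu>) = (\<integral>m. g (m 0) \<partial>\<mu>) + (\<integral>m. - G m \<partial>\<mu>)"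
    unfolding F_def using gb Gb
    by (intro Bochner_Integration.integral_add integrable_bounded[where b="potential_bound s"]
        integrable_bounded[where b="\<bar>ln a\<bar>"]) auto
  also have "\<dots> = s * lyapunov - entropy - ln a * mu.prob (visit i E)"
    using integral_potential[of s] E by (simp add: g_def G_def)
  finally have "\<kappa> < (\<integral>m. F m \<partial>\<mu>)" using mean by simp
  from birkhoff_sum_exceeds[OF F b this]
  have "AE m in \<mu>. \<forall>j::nat. \<exists>n. birkhoff_sum F n m > \<kappa> * real n + real j" by simp
  with AE_space show ?thesis
  proof eventually_elim
    case (elim m)
    then have m: "m \<in> symbolic_space M" by (simp add: space_mu)
    have b0: "0 \<le> b" using b[OF m] by linarith
    show ?case
    proof
      fix N :: nat
      \<comment> \<open>A sum above \<open>N b\<close> needs more than \<open>N\<close> terms.\<close>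
      obtain j :: nat where j: "real N * b \<le> real j" using real_arch_simple by blast
      obtain n where n: "birkhoff_sum F n m > \<kappa> * real n + real j" using elim by blast
      have "birkhoff_sum F n m \<le> real n * b"
        using birkhoff_sum_bound[where F=F and b=b and m=m and n=n, OF b m] by simp
      moreover have "0 \<le> \<kappa> * real n" using \<kappa> by simp
      ultimately have "real N * b < real n * b" using n j by linarith
      then have "N \<le> n" using b0 by (metis less_imp_le mult_less_cancel_right not_le of_nat_less_iff)
      moreover have "birkhoff_sum F n m = ln (word_prod q m n) - s * ln (word_prod r m n) - birkhoff_sum G n m"
        unfolding F_def birkhoff_sum_add birkhoff_sum_digit g_def
        by (simp add: birkhoff_sum_def ln_word_prod_q[OF m] ln_word_prod_r[OF m] sum_subtractf sum_distrib_left sum_negf)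
      ultimately show "\<exists>n\<ge>N. birkhoff_sum (\<lambda>m. ln a * indicator (visit i E) m) n m
        \<le> ln (word_prod q m n) - s * ln (word_prod r m n) - \<kappa> * real n"
        using n unfolding G_def by (intro exI[of _ n]) auto
    qed
  qed
qed

text \<open>Exchanging the sum over words of one scale with the integral over the centres of light balls leaves
  the mass of one such ball, by \<open>sum_cylinder_interval_le\<close>.\<close>

lemma emeasure_cheap_light:
  fixes n l D :: nat and \<epsilon> :: real
  assumes amb: "ambiguous i E a" and s: "0 \<le> s"
    and D: "2 * radius \<le> real D"
  defines "U \<equiv> {x. emeasure \<nu> (cball x (real D / 2 ^ l)) < ennreal \<epsilon>}"
  shows "emeasure \<mu> {m \<in> symbolic_space M. (1 / 2) ^ Suc l < word_prod r m n \<and> word_prod r m n \<le> (1 / 2) ^ l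
      \<and> birkhoff_sum (\<lambda>m. ln a * indicator (visit i E) m) n m
          \<le> ln (word_prod q m n) - s * ln (word_prod r m n) - \<kappa> * real n
      \<and> coding_map r u m \<in> U}
    \<le> ennreal (2 powr (s * real (Suc l)) * exp (- (\<kappa> * real n))) * ennreal \<epsilon>"
    (is "emeasure \<mu> ?S \<le> _")
proof -
  have E[measurable]: "E \<in> sets borel" using amb by (auto simp: ambiguous_def)
  have U[measurable]: "U \<in> sets borel"
    using emeasure_nu_ball_measurable[of "real D / 2 ^ l"] unfolding U_def by measurable
  define W where "W = {w \<in> words M n. (1 / 2) ^ Suc l < word_prod r w n \<and> word_prod r w n \<le> (1 / 2) ^ l}"
  have finW: "finite W" unfolding W_def by simp
  have Wd: "w k \<in> {1..M}" if "w \<in> W" "k < n" for w k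
    using that words_digit by (auto simp: W_def)
  define \<tau> where "\<tau> w = ln (word_prod q w n) - s * ln (word_prod r w n) - \<kappa> * real n" for w
  define c where "c = 2 powr (s * real (Suc l)) * exp (- (\<kappa> * real n))"
  define P where "P w = {m \<in> cylinder M w n. coding_map r u m \<in> U \<inter> cylinder_interval w n \<and>
      birkhoff_sum (\<lambda>m. ln a * indicator (visit i E) m) n m \<le> \<tau> w}" for w
  have Iw[measurable]: "cylinder_interval w n \<in> sets borel" for w
    by (simp add: cylinder_interval_def)
  have Pm: "P w \<in> sets \<mu>" for w
  proof -
    have "P w = {m \<in> space \<mu>. m \<in> cylinder M w n \<and> coding_map r u m \<in> U \<inter> cylinder_interval w n \<and>
      birkhoff_sum (\<lambda>m. ln a * indicator (visit i E) m) n m \<le> \<tau> w}"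
      by (auto simp: P_def cylinder_def space_mu)
    then show ?thesis by simp
  qed
  have sub: "?S \<subseteq> (\<Union>w\<in>W. P w)"
  proof
    fix m assume m: "m \<in> ?S"
    let ?w = "restrict m {..<n}"
    have mS: "m \<in> symbolic_space M" using m by simp
    have cyl: "m \<in> cylinder M ?w n" by (rule mem_cylinder_restrict[OF mS])
    have wp: "word_prod f ?w n = word_prod f m n" for f by (rule word_prod_cong) simp
    have "?w \<in> W" using m restrict_in_words[OF mS, of n] by (simp add: W_def wp)
    moreover have "m \<in> P ?w"
      using m cyl coding_map_in_interval[OF cyl] by (simp add: P_def \<tau>_def wp)
    ultimately show "m \<in> (\<Union>w\<in>W. P w)" by blast
  qed
  have exp\<tau>: "exp (\<tau> w) \<le> c * word_prod q w n" if w: "w \<in> W" for w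
  proof -
    have qp: "0 < word_prod q w n" using q_pos Wd[OF w] by (intro word_prod_pos) blast
    have rp: "0 < word_prod r w n" using Wd[OF w] by (intro word_prod_r_pos) blast
    have "- ln (word_prod r w n) \<le> - ln ((1 / 2) ^ Suc l)"
      using w rp by (subst neg_le_iff_le, subst ln_le_cancel_iff) (auto simp: W_def)
    also have "\<dots> = real (Suc l) * ln 2"
      by (subst ln_realpow) (auto simp: ln_div)
    finally have "s * (- ln (word_prod r w n)) \<le> s * (real (Suc l) * ln 2)"
      using s by (rule mult_left_mono)
    then have "\<tau> w \<le> ln (word_prod q w n) + (s * (real (Suc l) * ln 2)) - \<kappa> * real n"
      by (simp add: \<tau>_def)
    then have "exp (\<tau> w) \<le> exp (ln (word_prod q w n) + (s * (real (Suc l) * ln 2)) - \<kappa> * real n)"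
      by simp
    also have "\<dots> = c * word_prod q w n"
      unfolding exp_diff exp_add exp_ln[OF qp] c_def by (simp add: powr_def exp_minus divide_inverse mult_ac)
    finally show ?thesis .
  qed
  have "emeasure \<mu> ?S \<le> emeasure \<mu> (\<Union>w\<in>W. P w)"
    using sub Pm finW by (intro emeasure_mono) auto
  also have "\<dots> \<le> (\<Sum>w\<in>W. emeasure \<mu> (P w))"
    using Pm finW by (intro emeasure_subadditive_finite) auto
  also have "\<dots> \<le> (\<Sum>w\<in>W. ennreal c * (ennreal (word_prod q w n) * emeasure \<nu> (U \<inter> cylinder_interval w n)))"
  proof (rule sum_mono)
    fix w assume w: "w \<in> W"
    have q0: "0 \<le> word_prod q w n" using Wd[OF w] by (intro word_prod_q_nonneg) blast
    have "emeasure \<mu> (P w) \<le> ennreal (exp (\<tau> w)) * emeasure \<nu> (U \<inter> cylinder_interval w n)"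
      unfolding P_def by (rule emeasure_cylinder_visits[OF amb]) measurable
    also have "\<dots> \<le> ennreal (c * word_prod q w n) * emeasure \<nu> (U \<inter> cylinder_interval w n)"
      by (intro mult_right_mono ennreal_leI exp\<tau>[OF w]) auto
    also have "\<dots> = ennreal c * (ennreal (word_prod q w n) * emeasure \<nu> (U \<inter> cylinder_interval w n))"
      using q0 by (simp add: ennreal_mult c_def mult.assoc)
    finally show "emeasure \<mu> (P w) \<le> ennreal c * (ennreal (word_prod q w n) * emeasure \<nu> (U \<inter> cylinder_interval w n))" .
  qed
  also have "\<dots> = ennreal c * (\<Sum>w\<in>W. ennreal (word_prod q w n) * emeasure \<nu> (U \<inter> cylinder_interval w n))"
    by (rule sum_distrib_left[symmetric])
  also have "(\<Sum>w\<in>W. ennreal (word_prod q w n) * emeasure \<nu> (U \<inter> cylinder_interval w n))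
      = (\<Sum>w\<in>W. \<integral>\<^sup>+x. ennreal (word_prod q w n) * indicator (U \<inter> cylinder_interval w n) x \<partial>\<nu>)"
    by (intro sum.cong refl nn_integral_cmult_indicator[symmetric]) simp
  also have "\<dots> = (\<integral>\<^sup>+x. (\<Sum>w\<in>W. ennreal (word_prod q w n) * indicator (U \<inter> cylinder_interval w n) x) \<partial>\<nu>)"
    by (intro nn_integral_sum[symmetric]) measurable
  also have "\<dots> \<le> (\<integral>\<^sup>+x. ennreal \<epsilon> \<partial>\<nu>)"
  proof (rule nn_integral_mono)
    fix x
    show "(\<Sum>w\<in>W. ennreal (word_prod q w n) * indicator (U \<inter> cylinder_interval w n) x) \<le> ennreal \<epsilon>"
    proof (cases "x \<in> U")
      case True
      then have "(\<Sum>w\<in>W. ennreal (word_prod q w n) * indicator (U \<inter> cylinder_interval w n) x)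
          = (\<Sum>w\<in>W. ennreal (word_prod q w n) * indicator (cylinder_interval w n) x)"
        by (intro sum.cong refl) (simp add: indicator_def)
      also have "\<dots> \<le> emeasure \<nu> (cball x (real D / 2 ^ l))"
        using D by (intro sum_cylinder_interval_le) (auto simp: W_def)
      also have "\<dots> \<le> ennreal \<epsilon>" using True by (simp add: U_def)
      finally show ?thesis .
    qed simp
  qed
  also have "\<dots> = ennreal \<epsilon>"
    by (simp add: nu.emeasure_space_1[simplified])
  finally show ?thesis
    unfolding c_def by (simp add: mult_left_mono)
qed

text \<open>By Borel-Cantelli a generic sequence is only finitely often both cheap and coded into a light ball;
  it is cheap infinitely often, so its point has heavy balls at infinitely many scales.\<close>

lemma exists_full_null_hausdorff:
  assumes amb: "ambiguous i E a" and t: "0 < t" "entropy + ln a * mu.prob (visit i E) < t * lyapunov"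
  obtains A where "A \<in> sets borel" "emeasure \<nu> A = 1" "hausdorff_measure t A = 0"
proof -
  have E[measurable]: "E \<in> sets borel" using amb by (auto simp: ambiguous_def)
  define p where "p = entropy + ln a * mu.prob (visit i E)"
  define s\<^sub>0 where "s\<^sub>0 = max 0 (p / lyapunov)"
  have s0: "0 \<le> s\<^sub>0" "s\<^sub>0 < t" "p \<le> s\<^sub>0 * lyapunov"
    using t lyapunov_pos by (auto simp: s\<^sub>0_def p_def[symmetric] max_def field_simps)
  \<comment> \<open>Three exponents \<open>s < s' < t\<close>: the gap between \<open>s\<close> and \<open>s'\<close> makes the sum over scales converge,
    the gap between \<open>s'\<close> and \<open>t\<close> makes the covers small.\<close>
  define s where "s = (2 * s\<^sub>0 + t) / 3"
  define s' where "s' = (s\<^sub>0 + 2 * t) / 3"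
  have ss: "0 \<le> s" "s\<^sub>0 < s" "s < s'" "s' < t" "0 \<le> s'"
    using s0 by (auto simp: s_def s'_def field_simps)
  define \<kappa> where "\<kappa> = (s * lyapunov - p) / 2"
  have "p < s * lyapunov"
    using s0(3) ss(2) lyapunov_pos by (meson le_less_trans mult_strict_right_mono)
  then have \<kappa>: "0 < \<kappa>" "\<kappa> < s * lyapunov - entropy - ln a * mu.prob (visit i E)"
    by (auto simp: \<kappa>_def p_def)
  define D where "D = nat \<lceil>2 * radius\<rceil>"
  have D: "2 * radius \<le> real D"
    unfolding D_def by (rule real_nat_ceiling_ge)
  define U where "U l = {x. emeasure \<nu> (cball x (real D / 2 ^ l)) < ennreal (2 powr (- (s' * real l)))}" for l
  have U[measurable]: "U l \<in> sets borel" for l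
    using emeasure_nu_ball_measurable[of "real D / 2 ^ l"] unfolding U_def by measurable
  have notU: "x \<notin> U l \<longleftrightarrow> 2 powr (- (s' * real l)) \<le> measure \<nu> (cball x (real D / 2 ^ l))" for x l
    by (simp add: U_def nu.emeasure_eq_measure not_less)
  define A where "A = {x. \<exists>\<^sub>\<infinity>l. x \<notin> U l}"
  have A0: "hausdorff_measure t A = 0"
    unfolding A_def notU by (rule hausdorff_measure_limsup_heavy) (use ss nu.prob_space_axioms in auto)
  have A[measurable]: "A \<in> sets borel"
    unfolding A_def INFM_nat_le by measurable
  define cheap where "cheap n m \<longleftrightarrow> birkhoff_sum (\<lambda>m. ln a * indicator (visit i E) m) n m
          \<le> ln (word_prod q m n) - s * ln (word_prod r m n) - \<kappa> * real n" for n m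
  define bad where "bad n l = {m \<in> symbolic_space M. (1 / 2) ^ Suc l < word_prod r m n \<and> word_prod r m n \<le> (1 / 2) ^ l
      \<and> cheap n m \<and> coding_map r u m \<in> U l}" for n l
  have wpm[measurable]: "(\<lambda>m. word_prod f m n) \<in> borel_measurable \<mu>" for f n
    unfolding word_prod_def by (intro borel_measurable_prod measurable_compose[OF measurable_digit]) auto
  have bad[measurable]: "bad n l \<in> sets \<mu>" for n l
  proof -
    have G[measurable]: "birkhoff_sum (\<lambda>m. ln a * indicator (visit i E) m) n \<in> borel_measurable \<mu>"
      using visit_sets[OF E] by (intro birkhoff_sum_measurable borel_measurable_times) auto
    have c: "{m \<in> space \<mu>. cheap n m} \<in> sets \<mu>"
      unfolding cheap_def by measurable
    have w: "{m \<in> space \<mu>. (1 / 2) ^ Suc l < word_prod r m n} \<in> sets \<mu>"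
        "{m \<in> space \<mu>. word_prod r m n \<le> (1 / 2) ^ l} \<in> sets \<mu>"
      by measurable
    have "{m \<in> space \<mu>. (1 / 2) ^ Suc l < word_prod r m n} \<inter> {m \<in> space \<mu>. word_prod r m n \<le> (1 / 2) ^ l}
      \<inter> {m \<in> space \<mu>. cheap n m} \<inter> {m \<in> symbolic_space M. coding_map r u m \<in> U l} \<in> sets \<mu>"
      (is "?B \<in> _")
      by (intro sets.Int c w coding_preimage_sets[OF U])
    moreover have "bad n l = ?B"
      unfolding bad_def space_mu by blast
    ultimately show ?thesis by simp
  qed
  define \<theta> where "\<theta> = 2 powr (- (s' - s))"
  have \<theta>: "0 < \<theta>" "\<theta> < 1"
    using ss powr_less_mono[of "- (s' - s)" 0 2] by (auto simp: \<theta>_def)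
  define C where "C = 2 powr s / (1 - \<theta>)"
  have bad_le: "emeasure \<mu> (bad n l) \<le> ennreal (2 powr s * exp (- (\<kappa> * real n)) * \<theta> ^ l)" for n l
  proof -
    have "emeasure \<mu> (bad n l) \<le> ennreal (2 powr (s * real (Suc l)) * exp (- (\<kappa> * real n))) * ennreal (2 powr (- (s' * real l)))"
      unfolding bad_def cheap_def U_def by (rule emeasure_cheap_light[OF amb ss(1) D])
    also have "\<dots> = ennreal (2 powr (s * real (Suc l)) * exp (- (\<kappa> * real n)) * 2 powr (- (s' * real l)))"
      by (rule ennreal_mult[symmetric]) auto
    also have "2 powr (s * real (Suc l)) * exp (- (\<kappa> * real n)) * 2 powr (- (s' * real l))
        = exp (- (\<kappa> * real n)) * (2 powr (s * real (Suc l)) * 2 powr (- (s' * real l)))"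
      by simp
    also have "2 powr (s * real (Suc l)) * 2 powr (- (s' * real l)) = 2 powr s * 2 powr (- (s' - s) * real l)"
      unfolding powr_add[symmetric] by (simp add: algebra_simps)
    also have "2 powr (- (s' - s) * real l) = \<theta> ^ l"
      unfolding \<theta>_def powr_powr[symmetric] by (subst powr_realpow) auto
    finally show ?thesis by (simp add: mult_ac)
  qed
  have bad_sum: "measure \<mu> (\<Union>l. bad n l) \<le> C * exp (- \<kappa>) ^ n" for n
  proof -
    have "emeasure \<mu> (\<Union>l. bad n l) \<le> (\<Sum>l. emeasure \<mu> (bad n l))"
      by (rule emeasure_subadditive_countably) auto
    also have "\<dots> \<le> (\<Sum>l. ennreal (2 powr s * exp (- (\<kappa> * real n)) * \<theta> ^ l))"
      by (intro suminf_le bad_le) auto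
    also have "\<dots> = ennreal (2 powr s * exp (- (\<kappa> * real n)) * (1 / (1 - \<theta>)))"
      using \<theta> by (intro suminf_ennreal_eq sums_mult geometric_sums) auto
    also have "2 powr s * exp (- (\<kappa> * real n)) * (1 / (1 - \<theta>)) = C * exp (- \<kappa>) ^ n"
      by (simp add: C_def exp_of_nat_mult[symmetric] mult.commute)
    finally show ?thesis
      using \<theta> by (simp add: mu.emeasure_eq_measure C_def)
  qed
  have "summable (\<lambda>n. measure \<mu> (\<Union>l. bad n l))"
  proof (rule summable_comparison_test'[of _ 0])
    show "summable (\<lambda>n. C * exp (- \<kappa>) ^ n)"
      using \<kappa> by (intro summable_mult summable_geometric) auto
    show "norm (measure \<mu> (\<Union>l. bad n l)) \<le> C * exp (- \<kappa>) ^ n" for n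
      using bad_sum[of n] by simp
  qed
  then have "AE m in \<mu>. eventually (\<lambda>n. m \<in> space \<mu> - (\<Union>l. bad n l)) sequentially"
    by (intro borel_cantelli_AE1) (auto simp: less_top[symmetric])
  moreover have "AE m in \<mu>. \<forall>N. \<exists>n\<ge>N. cheap n m"
    unfolding cheap_def using amb less_imp_le[OF \<kappa>(1)] \<kappa>(2) by (rule cheap_words_infinitely_often)
  ultimately have "AE m in \<mu>. coding_map r u m \<in> A"
    using AE_space
  proof eventually_elim
    case (elim m)
    then have m: "m \<in> symbolic_space M" by (simp add: space_mu)
    obtain N\<^sub>1 where N1: "\<And>n. N\<^sub>1 \<le> n \<Longrightarrow> m \<notin> (\<Union>l. bad n l)"
      using elim(1) by (auto simp: eventually_sequentially)
    show ?case
      unfolding A_def INFM_nat_le mem_Collect_eq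
    proof
      fix L
      obtain N\<^sub>2 where N2: "max_ratio ^ N\<^sub>2 < (1 / 2) ^ L"
        using real_arch_pow_inv[of "(1 / 2) ^ L" max_ratio] max_ratio by auto
      obtain n where n: "max N\<^sub>1 N\<^sub>2 \<le> n" "cheap n m" using elim(2) by blast
      have wr: "0 < word_prod r m n" "word_prod r m n \<le> max_ratio ^ n"
        using word_prod_r_pos[of n m] word_prod_r_le[of n m] symbolic_space_digit[OF m] by auto
      have "max_ratio ^ n \<le> max_ratio ^ N\<^sub>2"
        using n(1) max_ratio by (intro power_decreasing) auto
      then have small: "word_prod r m n < (1 / 2) ^ L" using wr N2 by linarith
      have "word_prod r m n \<le> 1"
        using wr(2) max_ratio power_le_one[of max_ratio n] by linarith
      then obtain l where l: "(1 / 2) ^ Suc l < word_prod r m n" "word_prod r m n \<le> (1 / 2) ^ l"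
        using dyadic_scale_exists[OF wr(1)] by blast
      have "(1 / 2 :: real) ^ Suc l < (1 / 2) ^ L" using l(1) small by linarith
      then have "L < Suc l" by (subst (asm) power_strict_decreasing_iff) auto
      moreover have "coding_map r u m \<notin> U l"
        using N1[of n] n l m unfolding bad_def by auto
      ultimately show "\<exists>l\<ge>L. coding_map r u m \<notin> U l" by (intro exI[of _ l]) auto
    qed
  qed
  then have "AE x in \<nu>. x \<in> A"
    unfolding self_similar_measure_def by (subst AE_distr_iff) auto
  then have "emeasure \<nu> A = 1"
    using nu.emeasure_eq_1_AE A by simp
  then show ?thesis using that A A0 by blast
qed

end

section \<open>Full dimension implies unique coding\<close>

context bernoulli_ifs begin

lemma emeasure_visit_le: "E \<in> sets borel \<Longrightarrow> emeasure \<mu> (visit i E) \<le> emeasure \<nu> E"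
  by (simp add: emeasure_nu visit_def) (intro emeasure_mono coding_preimage_sets, auto)

text \<open>The conditional probability of the symbol \<open>i\<close> given the coded point is a Radon-Nikodym derivative.
  Its sublevel sets \<open>E k\<close> are ambiguous, hence carry no mass of \<open>i\<close>; where it is at least \<open>1\<close>,
  the symbol \<open>i\<close> takes up all of the mass of \<open>\<nu>\<close>.\<close>

lemma first_digit_decided:
  assumes unamb: "\<And>E a. ambiguous i E a \<Longrightarrow> a < 1 \<Longrightarrow> mu.prob (visit i E) = 0"
  obtains B where "B \<in> sets borel" "AE m in \<mu>. m 0 = i \<longleftrightarrow> coding_map r u m \<in> B"
proof -
  define N where "N = distr (density \<mu> (indicator (visit i UNIV))) borel (coding_map r u)"
  have setsN: "sets N = sets \<nu>" by (simp add: N_def)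
  have N: "emeasure N B = emeasure \<mu> (visit i B)" if [measurable]: "B \<in> sets borel" for B
  proof -
    have "emeasure N B = emeasure (density \<mu> (indicator (visit i UNIV))) (coding_map r u -` B \<inter> space \<mu>)"
      unfolding N_def by (subst emeasure_distr) auto
    also have "\<dots> = (\<integral>\<^sup>+m. indicator (visit i UNIV) m * indicator (coding_map r u -` B \<inter> space \<mu>) m \<partial>\<mu>)"
      by (rule emeasure_density) (auto intro!: measurable_sets[OF coding_map_measurable])
    also have "\<dots> = (\<integral>\<^sup>+m. indicator (visit i B) m \<partial>\<mu>)"
      by (intro nn_integral_cong) (auto simp: visit_def space_mu indicator_def)
    finally show ?thesis by simp
  qed
  have "absolutely_continuous \<nu> N"
    unfolding absolutely_continuous_def
  proof
    fix B assume B: "B \<in> null_sets \<nu>"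
    then have "emeasure N B \<le> 0"
      using N[of B] emeasure_visit_le[of B i] by (simp add: null_sets_def)
    then show "B \<in> null_sets N" using B setsN by (simp add: null_sets_def)
  qed
  then have dens: "density \<nu> (RN_deriv \<nu> N) = N"
    using setsN by (rule nu.density_RN_deriv)
  define f where "f = RN_deriv \<nu> N"
  have f[measurable]: "f \<in> borel_measurable borel"
    using borel_measurable_RN_deriv[of \<nu> N] unfolding f_def by simp
  have Nf: "emeasure N B = (\<integral>\<^sup>+x. f x * indicator B x \<partial>\<nu>)" if "B \<in> sets borel" for B
  proof -
    have "density \<nu> f = N" using dens by (simp only: f_def)
    with emeasure_density[of f \<nu> B] that show ?thesis by simp
  qed
  define a where "a k = 1 - 1 / real (k + 2)" for k :: nat
  have a: "0 < a k" "a k < 1" for k by (auto simp: a_def field_simps)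
  define E where "E k = {x. f x \<le> ennreal (a k)}" for k
  have E[measurable]: "E k \<in> sets borel" for k unfolding E_def by measurable
  have "ambiguous i (E k) (a k)" for k
    unfolding ambiguous_def
  proof (intro conjI ballI impI)
    fix B assume B: "B \<in> sets borel" "B \<subseteq> E k"
    have "emeasure \<mu> (visit i B) = (\<integral>\<^sup>+x. f x * indicator B x \<partial>\<nu>)"
      using N Nf B by simp
    also have "\<dots> \<le> (\<integral>\<^sup>+x. ennreal (a k) * indicator B x \<partial>\<nu>)"
      using B(2) by (intro nn_integral_mono) (auto simp: indicator_def E_def)
    also have "\<dots> = ennreal (a k) * emeasure \<nu> B"
      using B(1) by (intro nn_integral_cmult_indicator) simp
    finally show "emeasure \<mu> {m \<in> symbolic_space M. m 0 = i \<and> coding_map r u m \<in> B} \<le> ennreal (a k) * emeasure \<nu> B"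
      by (simp add: visit_def)
  qed (use a[of k] E in auto)
  then have null: "visit i (E k) \<in> null_sets \<mu>" for k
    using unamb[OF _ a(2)] by (auto simp: null_sets_def mu.emeasure_eq_measure)
  define B where "B = {x. 1 \<le> f x}"
  have B[measurable]: "B \<in> sets borel" unfolding B_def by measurable
  have "- B \<subseteq> (\<Union>k. E k)"
  proof
    fix x assume "x \<in> - B"
    then have x: "f x < 1" by (simp add: B_def)
    then obtain y where y: "f x = ennreal y" "0 \<le> y" by (cases "f x") auto
    then have "y < 1" using x by simp
    then obtain k :: nat where k: "inverse (real (Suc k)) < 1 - y"
      using reals_Archimedean[of "1 - y"] by auto
    have "1 / real (k + 2) \<le> inverse (real (Suc k))" by (simp add: field_simps)
    then have "y \<le> a k" using k by (simp add: a_def)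
    then show "x \<in> (\<Union>k. E k)" using y by (auto simp: E_def intro!: ennreal_leI exI[of _ k])
  qed
  then have "visit i (- B) \<subseteq> (\<Union>k. visit i (E k))"
    by (auto simp: visit_def)
  moreover have "(\<Union>k. visit i (E k)) \<in> null_sets \<mu>"
    using null by (intro null_sets_UN) auto
  ultimately have null1: "visit i (- B) \<in> null_sets \<mu>"
    by (rule null_sets_subset[rotated 2]) measurable
  define P where "P = {m \<in> symbolic_space M. coding_map r u m \<in> B}"
  have P: "P \<in> sets \<mu>" unfolding P_def by (rule coding_preimage_sets[OF B])
  have "emeasure \<mu> P = emeasure \<nu> B"
    by (simp add: emeasure_nu P_def)
  also have "\<dots> = (\<integral>\<^sup>+x. indicator B x \<partial>\<nu>)" by simp
  also have "\<dots> \<le> (\<integral>\<^sup>+x. f x * indicator B x \<partial>\<nu>)"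
    by (intro nn_integral_mono) (auto simp: indicator_def B_def)
  also have "\<dots> = emeasure \<mu> (visit i B)"
    using N Nf B by simp
  finally have "emeasure \<mu> P \<le> emeasure \<mu> (visit i B)" .
  moreover have sub: "visit i B \<subseteq> P" by (auto simp: visit_def P_def)
  ultimately have "emeasure \<mu> (P - visit i B) = 0"
    using P visit_sets[OF B, of i] emeasure_mono[OF sub P]
    by (subst emeasure_Diff) (auto intro: diff_eq_0_ennreal simp: less_top[symmetric])
  then have null2: "P - visit i B \<in> null_sets \<mu>"
    using P visit_sets[OF B, of i] by auto
  have "AE m in \<mu>. m 0 = i \<longleftrightarrow> coding_map r u m \<in> B"
    using AE_not_in[OF null1] AE_not_in[OF null2] AE_space
    by eventually_elim (auto simp: visit_def P_def space_mu)
  then show ?thesis using that B by blast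
qed

text \<open>Off a null set the point determines the first symbol, hence also the point coded by the shifted
  sequence, and so on along the orbit.\<close>

lemma unique_coding_if_unambiguous:
  assumes unamb: "\<And>i E a. i \<in> {1..M} \<Longrightarrow> ambiguous i E a \<Longrightarrow> a < 1 \<Longrightarrow> mu.prob (visit i E) = 0"
  shows "\<exists>B \<in> null_sets \<mu>. \<forall>m \<in> symbolic_space M - B. card (coding_fibre M r u m - B) = 1"
proof -
  have "\<forall>i\<in>{1..M}. \<exists>B. AE m in \<mu>. m 0 = i \<longleftrightarrow> coding_map r u m \<in> B"
  proof
    fix i assume i: "i \<in> {1..M}"
    show "\<exists>B. AE m in \<mu>. m 0 = i \<longleftrightarrow> coding_map r u m \<in> B"
      by (rule first_digit_decided[of i, OF unamb[OF i]]) blast+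
  qed
  from bchoice[OF this] obtain B where B: "\<And>i. i \<in> {1..M} \<Longrightarrow> AE m in \<mu>. m 0 = i \<longleftrightarrow> coding_map r u m \<in> B i"
    by blast
  then have "AE m in \<mu>. \<forall>i\<in>{1..M}. m 0 = i \<longleftrightarrow> coding_map r u m \<in> B i"
    by (intro AE_finite_allI) auto
  then obtain N where N: "{m \<in> space \<mu>. \<not> (\<forall>i\<in>{1..M}. m 0 = i \<longleftrightarrow> coding_map r u m \<in> B i)} \<subseteq> N" "N \<in> null_sets \<mu>"
    by (auto elim!: AE_E simp: null_sets_def)
  define N' where "N' = (\<Union>k. {m \<in> space \<mu>. (\<lambda>j. m (j + k)) \<in> N})"
  have null: "N' \<in> null_sets \<mu>"
    unfolding N'_def using null_set_shift[OF N(2)] by (intro null_sets_UN) auto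
  have first: "m k = m' k" if "m \<in> symbolic_space M - N'" "m' \<in> symbolic_space M - N'"
    "coding_map r u (\<lambda>j. m (j + k)) = coding_map r u (\<lambda>j. m' (j + k))" for m m' k
  proof -
    have decided: "x k = i \<longleftrightarrow> coding_map r u (\<lambda>j. x (j + k)) \<in> B i"
      if "x \<in> symbolic_space M - N'" "i \<in> {1..M}" for x i
    proof -
      have "(\<lambda>j. x (j + k)) \<notin> N" using that(1) by (auto simp: N'_def space_mu)
      moreover have "(\<lambda>j. x (j + k)) \<in> symbolic_space M"
        using that(1) by (intro symbolic_space_shift_iterate) blast
      ultimately have "\<forall>i\<in>{1..M}. (\<lambda>j. x (j + k)) 0 = i \<longleftrightarrow> coding_map r u (\<lambda>j. x (j + k)) \<in> B i"
        using N(1) unfolding space_mu by blast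
      then show ?thesis
        using that(2) by simp
    qed
    have "m k \<in> {1..M}" using that(1) symbolic_space_digit by blast
    then show ?thesis using decided[OF that(1)] decided[OF that(2)] that(3) by metis
  qed
  have inj: "m = m'" if m: "m \<in> symbolic_space M - N'" "m' \<in> symbolic_space M - N'"
    "coding_map r u m = coding_map r u m'" for m m'
  proof -
    have "coding_map r u (\<lambda>j. m (j + k)) = coding_map r u (\<lambda>j. m' (j + k))" for k
    proof (induction k)
      case (Suc k)
      have dig: "m k = m' k" by (rule first[OF m(1,2) Suc])
      have rec: "coding_map r u (\<lambda>j. x (j + k)) = r (x k) * coding_map r u (\<lambda>j. x (j + Suc k)) + u (x k)"
        if "x \<in> symbolic_space M" for x
        using coding_map_shift[OF symbolic_space_shift_iterate[OF that, of k]] by (simp add: shift_def)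
      have "r (m k) > 0" using m(1) symbolic_space_digit[of m M k] ratio by auto
      then show ?case
        using Suc rec[of m] rec[of m'] m(1,2) dig by auto
    qed (use m(3) in simp)
    then show ?thesis using first[OF m(1,2)] by blast
  qed
  have "card (coding_fibre M r u m - N') = 1" if m: "m \<in> symbolic_space M - N'" for m
  proof -
    have "x = m" if "x \<in> coding_fibre M r u m - N'" for x
      using that inj[of x m] m by (auto simp: coding_fibre_def)
    moreover have "m \<in> coding_fibre M r u m - N'"
      using m by (simp add: coding_fibre_def)
    ultimately have "coding_fibre M r u m - N' = {m}" by blast
    then show ?thesis by simp
  qed
  with null show ?thesis by blast
qed

lemma dim_measure_le:
  assumes "A \<in> sets borel" "emeasure \<nu> A = 1" "hausdorff_measure t A = 0" "0 \<le> t"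
  shows "hausdorff_dim_measure \<nu> \<le> ereal t"
proof -
  have "hausdorff_dim_measure \<nu> \<le> hausdorff_dim A"
    unfolding hausdorff_dim_measure_def using assms by (intro INF_lower) auto
  also have "\<dots> \<le> ereal t"
    unfolding hausdorff_dim_def using assms by (intro INF_lower) auto
  finally show ?thesis .
qed

text \<open>The empty set is ambiguous with \<open>a = 1\<close>, and then the critical exponent is \<open>entropy / lyapunov\<close>.\<close>

lemma dim_measure_upper: "hausdorff_dim_measure \<nu> \<le> ereal (entropy / lyapunov)"
proof (rule ereal_le_epsilon2)
  fix e :: real assume e: "0 < e"
  have "ambiguous 1 {} 1" by (simp add: ambiguous_def)
  moreover have "0 < entropy / lyapunov + e"
    using e entropy_nonneg lyapunov_pos by (intro add_nonneg_pos divide_nonneg_pos) auto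
  moreover have "entropy + ln 1 * mu.prob (visit 1 {}) < (entropy / lyapunov + e) * lyapunov"
    using e lyapunov_pos by (simp add: field_simps)
  ultimately obtain A where "A \<in> sets borel" "emeasure \<nu> A = 1" "hausdorff_measure (entropy / lyapunov + e) A = 0"
    by (rule exists_full_null_hausdorff)
  then show "hausdorff_dim_measure \<nu> \<le> ereal (entropy / lyapunov) + ereal e"
    using dim_measure_le[of A "entropy / lyapunov + e"] \<open>0 < entropy / lyapunov + e\<close> by simp
qed

text \<open>Visits of positive measure push the critical exponent of the upper bound strictly below
  \<open>entropy / lyapunov\<close>.\<close>

lemma dimension_drop:
  assumes amb: "ambiguous i E a" and a: "a < 1" and pos: "0 < mu.prob (visit i E)" and i: "i \<in> {1..M}"
  shows "hausdorff_dim_measure \<nu> < ereal (entropy / lyapunov)"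
proof -
  have E: "E \<in> sets borel" and a0: "0 < a" using amb by (auto simp: ambiguous_def)
  have "entropy \<noteq> 0"
  proof
    \<comment> \<open>Without entropy the only symbol has probability one, so it cannot be ambiguous.\<close>
    assume "entropy = 0"
    then have "(\<Sum>j\<in>{1..M}. - (q j * ln (q j))) = 0"
      by (simp add: entropy_def sum_negf)
    moreover have "0 \<le> - (q j * ln (q j))" if "j \<in> {1..M}" for j
      using q_pos[OF that] q_le_1[OF that] by (simp add: mult_nonneg_nonpos)
    ultimately have "- (q i * ln (q i)) = 0"
      using i by (subst (asm) sum_nonneg_eq_0_iff) auto
    then have "q i = 1" using q_pos[OF i] by auto
    then have "emeasure \<mu> (cylinder M (\<lambda>_. i) 1) = 1"
      using emeasure_cylinder[of 1 "\<lambda>_. i"] i by (simp add: word_prod_Suc)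
    then have "AE m in \<mu>. m \<in> cylinder M (\<lambda>_. i) 1"
      by (subst mu.AE_in_set_eq_1) (simp_all add: measure_def)
    then have "emeasure \<mu> {m \<in> symbolic_space M. coding_map r u m \<in> E} = emeasure \<mu> (visit i E)"
      by (intro emeasure_eq_AE coding_preimage_sets E visit_sets) (auto simp: cylinder_def visit_def)
    then have "emeasure \<mu> (visit i E) \<le> ennreal a * emeasure \<mu> (visit i E)"
      using amb E unfolding ambiguous_def visit_def by (auto simp: emeasure_nu)
    then have "mu.prob (visit i E) \<le> a * mu.prob (visit i E)"
      using a0 by (simp add: mu.emeasure_eq_measure ennreal_mult[symmetric])
    then show False using pos a by simp
  qed
  then have h: "0 < entropy" using entropy_nonneg by simp
  define p where "p = entropy + ln a * mu.prob (visit i E)"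
  have "p < entropy"
    using a a0 pos by (simp add: p_def mult_neg_pos)
  then have "max 0 (p / lyapunov) < entropy / lyapunov"
    using h lyapunov_pos by (simp add: divide_strict_right_mono)
  then obtain t where t: "max 0 (p / lyapunov) < t" "t < entropy / lyapunov"
    using dense by blast
  then have "0 < t" "p < t * lyapunov"
    using lyapunov_pos by (auto simp: field_simps)
  then obtain A where "A \<in> sets borel" "emeasure \<nu> A = 1" "hausdorff_measure t A = 0"
    using exists_full_null_hausdorff[OF amb] unfolding p_def by blast
  then have "hausdorff_dim_measure \<nu> \<le> ereal t"
    using \<open>0 < t\<close> by (intro dim_measure_le) auto
  also have "\<dots> < ereal (entropy / lyapunov)" using t by simp
  finally show ?thesis .
qed

end

section \<open>Separated sequences and the number of words\<close>

context bernoulli_ifs begin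

text \<open>Sequences of symbols are moved into the Polish space of real sequences, on which finite Borel
  measures are inner regular.\<close>

definition decode :: "(nat \<Rightarrow> real) \<Rightarrow> nat \<Rightarrow> nat" where
  "decode y = (\<lambda>k. nat \<lfloor>y k\<rfloor>)"

definition encode :: "(nat \<Rightarrow> nat) \<Rightarrow> nat \<Rightarrow> real" where
  "encode m = (\<lambda>k. real (m k))"

definition code_set :: "(nat \<Rightarrow> real) set" where
  "code_set = {y. \<forall>k. y k \<in> real ` {1..M}}"

lemma decode_encode [simp]: "decode (encode m) = m"
  by (simp add: decode_def encode_def)

lemma encode_decode: "y \<in> code_set \<Longrightarrow> encode (decode y) = y"
proof
  fix k assume "y \<in> code_set"
  then obtain j where "y k = real j" by (auto simp: code_set_def)
  then show "encode (decode y) k = y k" by (simp add: encode_def decode_def)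
qed

lemma decode_in_symbolic_space: "y \<in> code_set \<Longrightarrow> decode y \<in> symbolic_space M"
proof -
  assume y: "y \<in> code_set"
  have "decode y k \<in> {1..M}" for k
  proof -
    have "y k \<in> real ` {1..M}" using y by (simp only: code_set_def mem_Collect_eq)
    then obtain j where "y k = real j" "j \<in> {1..M}" by (rule imageE)
    then show ?thesis by (simp add: decode_def)
  qed
  then show ?thesis by (simp add: symbolic_space_def)
qed

lemma encode_in_code_set: "m \<in> symbolic_space M \<Longrightarrow> encode m \<in> code_set"
  using symbolic_space_digit by (fastforce simp: encode_def code_set_def)

lemma code_set_borel: "code_set \<in> sets borel"
proof -
  have "code_set = (\<Inter>k. (\<lambda>y. y k) -` (real ` {1..M}) \<inter> space borel)"
    by (auto simp: code_set_def)
  also have "\<dots> \<in> sets borel"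
  proof (intro sets.countable_INT')
    have "real ` {1..M} \<in> sets borel"
      by (intro borel_closed finite_imp_closed finite_imageI) simp
    then have "(\<lambda>y :: nat \<Rightarrow> real. y k) -` (real ` {1..M}) \<inter> space borel \<in> sets borel" for k
      by (rule measurable_sets[OF measurable_product_coordinates])
    then show "(\<lambda>k. (\<lambda>y :: nat \<Rightarrow> real. y k) -` (real ` {1..M}) \<inter> space borel) ` UNIV \<subseteq> sets borel"
      by (rule image_subsetI)
  qed simp_all
  finally show ?thesis .
qed

lemma continuous_on_decode_digit:
  fixes g :: "nat \<Rightarrow> real"
  shows "continuous_on code_set (\<lambda>y. g (decode y k))"
proof -
  have "continuous_on (real ` {1..M}) (\<lambda>x. g (nat \<lfloor>x\<rfloor>))"
    by (rule continuous_on_finite) simp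
  moreover have "continuous_on code_set (\<lambda>y. y k)"
    by (rule continuous_on_subset[OF continuous_on_product_coordinates]) simp
  ultimately show ?thesis
    unfolding decode_def by (rule continuous_on_compose2) (auto simp: code_set_def)
qed

lemma continuous_on_coding_map: "continuous_on code_set (\<lambda>y. coding_map r u (decode y))"
proof -
  have unif: "uniform_limit code_set (\<lambda>n y. \<Sum>k<n. word_prod r (decode y) k * u (decode y k))
      (\<lambda>y. \<Sum>k. word_prod r (decode y) k * u (decode y k)) sequentially"
  proof (rule Weierstrass_m_test)
    fix n y assume y: "y \<in> code_set"
    note dig = symbolic_space_digit[OF decode_in_symbolic_space[OF y]]
    show "norm (word_prod r (decode y) n * u (decode y n)) \<le> max_ratio ^ n * max_shift"
      using word_prod_r_le[of n "decode y"] word_prod_r_pos[of n "decode y"] dig abs_u_le[OF dig[of n]] max_ratio(1)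
      by (simp add: abs_mult mult_mono less_imp_le)
  next
    show "summable (\<lambda>n. max_ratio ^ n * max_shift)"
      using max_ratio by (intro summable_mult2 summable_geometric) auto
  qed
  have "continuous_on code_set (\<lambda>y. \<Sum>k. word_prod r (decode y) k * u (decode y k))"
  proof (rule uniform_limit_theorem[OF _ unif])
    show "\<forall>\<^sub>F n in sequentially. continuous_on code_set (\<lambda>y. \<Sum>k<n. word_prod r (decode y) k * u (decode y k))"
      unfolding word_prod_def
      by (intro always_eventually allI continuous_on_sum continuous_on_mult continuous_on_prod continuous_on_decode_digit)
  qed simp
  then show ?thesis
    by (rule continuous_on_eq) (simp add: coding_series(2) decode_in_symbolic_space)
qed

text \<open>Inner regularity on the sequence space turns injectivity off a null set into a uniform gap:
  on a compact set of almost full measure, points with different first symbols are coded at a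
  distance bounded below.\<close>

lemma separated_subset:
  assumes N: "N \<in> null_sets \<mu>" and e: "0 < e"
    and inj: "inj_on (coding_map r u) (symbolic_space M - N)"
  obtains K c where "K \<in> sets \<mu>" "mu.prob (space \<mu> - K) < e" "0 < c"
    "\<And>m m'. m \<in> K \<Longrightarrow> m' \<in> K \<Longrightarrow> m 0 \<noteq> m' 0 \<Longrightarrow> c \<le> \<bar>coding_map r u m - coding_map r u m'\<bar>"
proof -
  have enc[measurable]: "encode \<in> borel_measurable \<mu>"
    unfolding encode_def[abs_def]
    by (intro measurable_coordinatewise_then_product measurable_compose[OF measurable_digit]) simp
  define R where "R = restrict_space (borel :: (nat \<Rightarrow> real) measure) code_set"
  have spR: "space R = code_set" by (simp add: R_def space_restrict_space)
  have dec: "decode \<in> measurable R \<mu>"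
  proof (rule measurable_into_mu)
    fix k
    have "(\<lambda>y. nat \<lfloor>y k\<rfloor>) \<in> measurable (borel :: (nat \<Rightarrow> real) measure) (count_space UNIV)"
      by (intro measurable_compose[OF measurable_product_coordinates]
          measurable_compose[OF measurable_real_floor]) simp
    then show "(\<lambda>y. decode y k) \<in> measurable R (count_space UNIV)"
      unfolding R_def decode_def by (rule measurable_restrict_space1)
  qed (simp add: spR decode_in_symbolic_space)
  define X where "X = symbolic_space M - N"
  have X: "X \<in> sets \<mu>"
    using N sets.top[of \<mu>] unfolding X_def space_mu[symmetric] by auto
  define Y where "Y = decode -` X \<inter> space R"
  have "Y \<in> sets R" unfolding Y_def using dec X by (rule measurable_sets)
  then have Y: "Y \<in> sets borel"
    unfolding R_def using code_set_borel by (simp add: sets_restrict_space_iff)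
  define \<eta> where "\<eta> = distr \<mu> borel encode"
  interpret eta: prob_space \<eta>
    unfolding \<eta>_def by (rule mu.prob_space_distr) measurable
  have "emeasure \<eta> Y = emeasure \<mu> (encode -` Y \<inter> space \<mu>)"
    unfolding \<eta>_def by (rule emeasure_distr[OF enc Y])
  also have "encode -` Y \<inter> space \<mu> = X"
    using encode_in_code_set by (auto simp: Y_def spR space_mu X_def)
  also have "emeasure \<mu> X = emeasure \<mu> (space \<mu>)"
    unfolding X_def space_mu[symmetric] using N by (rule emeasure_Diff_null_set) simp
  finally have "emeasure \<eta> Y = 1" by (simp add: mu.emeasure_space_1)
  moreover have "emeasure \<eta> Y = (SUP K \<in> {K. K \<subseteq> Y \<and> compact K}. emeasure \<eta> K)"
  proof (rule inner_regular)
    show "sets \<eta> = sets borel" by (simp add: \<eta>_def)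
    show "emeasure \<eta> (space \<eta>) \<noteq> \<infinity>" by (simp add: eta.emeasure_space_1)
  qed (rule Y)
  ultimately have sup: "(SUP K \<in> {K. K \<subseteq> Y \<and> compact K}. emeasure \<eta> K) = 1" by simp
  have "ennreal (1 - e) < 1"
    using e by (simp add: ennreal_less_one_iff)
  then obtain K' where K': "K' \<subseteq> Y" "compact K'" "ennreal (1 - e) < emeasure \<eta> K'"
    unfolding sup[symmetric] less_SUP_iff by blast
  have K'S: "y \<in> code_set" "decode y \<in> X" if "y \<in> K'" for y
    using that K'(1) by (auto simp: Y_def spR)
  define K where "K = encode -` K' \<inter> space \<mu>"
  have K'b: "K' \<in> sets borel" using K'(2) by (simp add: borel_compact)
  have K: "K \<in> sets \<mu>"
    unfolding K_def using enc K'b by (rule measurable_sets)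
  have "emeasure \<eta> K' = emeasure \<mu> K"
    unfolding \<eta>_def K_def by (rule emeasure_distr[OF enc K'b])
  then have "ennreal (1 - e) < ennreal (mu.prob K)"
    using K'(3) by (simp add: mu.emeasure_eq_measure)
  then have "1 - e < mu.prob K"
    using ennreal_leI[of "mu.prob K" "1 - e"] by (meson not_le)
  then have small: "mu.prob (space \<mu> - K) < e"
    using mu.prob_compl[OF K] by simp
  define T where "T = (K' \<times> K') \<inter> {p. 1 \<le> \<bar>fst p 0 - snd p 0\<bar>}"
  have "continuous_on UNIV (\<lambda>p :: (nat \<Rightarrow> real) \<times> (nat \<Rightarrow> real). \<bar>fst p 0 - snd p 0\<bar>)"
    by (intro continuous_intros continuous_on_compose2[OF continuous_on_product_coordinates]) auto
  then have "closed {p :: (nat \<Rightarrow> real) \<times> (nat \<Rightarrow> real). 1 \<le> \<bar>fst p 0 - snd p 0\<bar>}"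
    by (intro closed_Collect_le continuous_on_const)
  then have T: "compact T"
    unfolding T_def using K'(2) by (intro compact_Int_closed compact_Times)
  define f where "f p = \<bar>coding_map r u (decode (fst p)) - coding_map r u (decode (snd p))\<bar>" for p
  have contf: "continuous_on T f"
    unfolding f_def using K'S(1)
    by (intro continuous_on_rabs continuous_on_diff continuous_on_compose2[OF continuous_on_coding_map]
        continuous_on_fst continuous_on_snd continuous_on_id) (auto simp: T_def)
  have fpos: "0 < f p" if p: "p \<in> T" for p
  proof (rule ccontr)
    assume "\<not> 0 < f p"
    then have "coding_map r u (decode (fst p)) = coding_map r u (decode (snd p))" by (simp add: f_def)
    moreover have "fst p \<in> K'" "snd p \<in> K'" using p by (auto simp: T_def)
    ultimately have "decode (fst p) = decode (snd p)"
      using inj_onD[OF inj] K'S(2) unfolding X_def by blast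
    then have "fst p = snd p"
      using encode_decode K'S(1) \<open>fst p \<in> K'\<close> \<open>snd p \<in> K'\<close> by metis
    then show False using p by (simp add: T_def)
  qed
  have "\<exists>c>0. \<forall>p\<in>T. c \<le> f p"
  proof (cases "T = {}")
    case False
    then obtain p where "p \<in> T" "\<forall>x\<in>T. f p \<le> f x"
      using continuous_attains_inf[OF T _ contf] by blast
    then show ?thesis using fpos by blast
  qed (auto intro: exI[of _ 1])
  then obtain c where c: "0 < c" "\<And>p. p \<in> T \<Longrightarrow> c \<le> f p" by blast
  have "c \<le> \<bar>coding_map r u m - coding_map r u m'\<bar>" if "m \<in> K" "m' \<in> K" "m 0 \<noteq> m' 0" for m m'
  proof -
    have "1 \<le> \<bar>real (m 0) - real (m' 0)\<bar>" using that(3) by linarith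
    then have "(encode m, encode m') \<in> T"
      using that by (auto simp: T_def K_def encode_def)
    then show ?thesis using c(2) by (force simp: f_def)
  qed
  with that K small c(1) show ?thesis by blast
qed

lemma sum_Pow_card:
  fixes y :: real
  assumes "finite A"
  shows "(\<Sum>S\<in>Pow A. y ^ card S) = (y + 1) ^ card A"
  using prod_add[OF assms, of "\<lambda>_. y" "\<lambda>_. 1"] by simp

text \<open>At a time outside \<open>S\<close> both shifted sequences lie in \<open>K\<close>, and different next symbols would separate the
  coded points by more than \<open>\<delta>\<close>.  A word is therefore determined by its symbols at the times in
  \<open>S\<close>.\<close>

lemma card_words_same_bad_times:
  fixes K :: "(nat \<Rightarrow> nat) set"
  assumes sep: "\<And>m m'. m \<in> K \<Longrightarrow> m' \<in> K \<Longrightarrow> m 0 \<noteq> m' 0 \<Longrightarrow> c \<le> \<bar>coding_map r u m - coding_map r u m'\<bar>"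
    and Q: "Q \<subseteq> symbolic_space M" "\<And>m m'. m \<in> Q \<Longrightarrow> m' \<in> Q \<Longrightarrow> \<bar>coding_map r u m - coding_map r u m'\<bar> \<le> \<delta>"
      "\<And>m k. m \<in> Q \<Longrightarrow> k < n \<Longrightarrow> \<delta> < c * word_prod r m k"
      "\<And>m. m \<in> Q \<Longrightarrow> {k. k < n \<and> (\<lambda>j. m (j + k)) \<notin> K} = S"
  shows "card ((\<lambda>m. restrict m {..<n}) ` Q) \<le> M ^ card S"
proof (cases "Q = {}")
  case False
  then have Sn: "S \<subseteq> {..<n}" using Q(4) by blast
  then have finS: "finite S" using finite_subset by blast
  have inj: "inj_on (\<lambda>w. restrict w S) ((\<lambda>m. restrict m {..<n}) ` Q)"
  proof (rule inj_onI, clarify)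
    fix m m' assume m: "m \<in> Q" "m' \<in> Q"
      and eq: "restrict (restrict m {..<n}) S = restrict (restrict m' {..<n}) S"
    have mS: "m \<in> symbolic_space M" "m' \<in> symbolic_space M" using m Q(1) by auto
    have "m k = m' k" if "k < n" for k
      using that
    proof (induction k rule: less_induct)
      case (less k)
      show ?case
      proof (cases "k \<in> S")
        case True
        then show ?thesis using fun_cong[OF eq, of k] less.prems by simp
      next
        case False
        show ?thesis
        proof (rule ccontr)
          assume ne: "m k \<noteq> m' k"
          have pre: "\<And>j. j < k \<Longrightarrow> m j = m' j" using less by simp
          have cm: "cylinder_map r u m k 0 = cylinder_map r u m' k 0"
            by (rule cylinder_map_cong) (rule pre)
          have wp: "word_prod r m k = word_prod r m' k"
            by (rule word_prod_cong) (rule pre)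
          have pos: "0 < word_prod r m k"
            using word_prod_r_pos symbolic_space_digit[OF mS(1)] by blast
          have "(\<lambda>j. m (j + k)) \<in> K" "(\<lambda>j. m' (j + k)) \<in> K"
            using False less.prems Q(4)[OF m(1)] Q(4)[OF m(2)] by auto
          then have "c \<le> \<bar>coding_map r u (\<lambda>j. m (j + k)) - coding_map r u (\<lambda>j. m' (j + k))\<bar>"
            by (rule sep) (use ne in simp)
          then have "c * word_prod r m k \<le> \<bar>coding_map r u (\<lambda>j. m (j + k)) - coding_map r u (\<lambda>j. m' (j + k))\<bar> * word_prod r m k"
            using pos by (intro mult_right_mono) auto
          also have "\<dots> = \<bar>coding_map r u m - coding_map r u m'\<bar>"
          proof -
            have "coding_map r u m - coding_map r u m'
                = (coding_map r u (\<lambda>j. m (j + k)) - coding_map r u (\<lambda>j. m' (j + k))) * word_prod r m k"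
              unfolding coding_map_split[OF mS(1), of k] coding_map_split[OF mS(2), of k] cm wp
              by (simp only: left_diff_distrib right_diff_distrib mult.commute add_diff_cancel_right)
            then show ?thesis using pos by (simp only: abs_mult abs_of_pos)
          qed
          finally show False using Q(2)[OF m] Q(3)[OF m(1) less.prems] by linarith
        qed
      qed
    qed
    then show "restrict m {..<n} = restrict m' {..<n}" by (auto simp: restrict_def)
  qed
  have "card ((\<lambda>m. restrict m {..<n}) ` Q) \<le> card (PiE S (\<lambda>_. {1..M}))"
  proof (rule card_inj_on_le[OF inj])
    show "(\<lambda>w. restrict w S) ` (\<lambda>m. restrict m {..<n}) ` Q \<subseteq> PiE S (\<lambda>_. {1..M})"
      using Sn Q(1) symbolic_space_digit by (fastforce simp: PiE_def Pi_def extensional_def)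
  qed (simp add: finite_PiE finS)
  then show ?thesis by (simp add: card_PiE[OF finS])
qed simp

end

section \<open>Unique coding implies full dimension\<close>

context bernoulli_ifs begin

text \<open>Frostman's condition on a set of positive measure.  The function to which the maximal
  ergodic theorem applies is chosen so that on that set every word satisfies
  \<open>q\<^sub>w \<le> r\<^sub>w\<^bsup>s\<^esup> e\<^bsup>-\<kappa>n - L|S|\<^esup>\<close> with \<open>S\<close> the set of bad times; the factor
  \<open>e\<^bsup>-L|S|\<^esup>\<close> pays for the \<open>M\<^bsup>|S|\<^esup>\<close> words and for the choice of \<open>S\<close>.\<close>

lemma frostman_subset:
  assumes N: "N \<in> null_sets \<mu>" and s: "0 \<le> s" "s * lyapunov < entropy"
    and inj: "inj_on (coding_map r u) (symbolic_space M - N)"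
  obtains A C where "A \<in> sets \<mu>" "0 < mu.prob A" "0 < C"
    "\<And>x \<rho>. 0 < \<rho> \<Longrightarrow> emeasure \<mu> {m \<in> A. coding_map r u m \<in> cball x \<rho>} \<le> ennreal (C * \<rho> powr s)"
proof -
  \<comment> \<open>One third of the available gap is spent on the rate \<open>\<kappa>\<close> and one third on visits outside \<open>K\<close>.\<close>
  define \<kappa> where "\<kappa> = (entropy - s * lyapunov) / 3"
  have \<kappa>: "0 < \<kappa>" using s by (simp add: \<kappa>_def)
  obtain L where L: "0 < L" "real M * exp (- L) + 1 \<le> exp (\<kappa> / 2)"
  proof -
    define d where "d = exp (\<kappa> / 2) - 1"
    have d: "0 < d" using \<kappa> by (simp add: d_def)
    have Mr: "0 < real M" using M_pos by simp
    define L where "L = max 1 (- ln (d / real M))"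
    have "exp (- L) \<le> exp (ln (d / real M))" by (simp add: L_def)
    also have "\<dots> = d / real M" using d Mr by simp
    finally have "real M * exp (- L) \<le> d" using Mr by (simp add: field_simps)
    then show thesis using that[of L] by (simp add: L_def d_def)
  qed
  obtain K c where K: "K \<in> sets \<mu>" "mu.prob (space \<mu> - K) < \<kappa> / L" and c: "0 < c"
    and sep: "\<And>m m'. m \<in> K \<Longrightarrow> m' \<in> K \<Longrightarrow> m 0 \<noteq> m' 0 \<Longrightarrow> c \<le> \<bar>coding_map r u m - coding_map r u m'\<bar>"
    using separated_subset[OF N divide_pos_pos[OF \<kappa> L(1)] inj] by blast
  define g where "g i = ln (q i) - s * ln (r i)" for i
  define F where "F m = L * indicator (space \<mu> - K) m + (g (m 0) + \<kappa>)" for m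
  have gm[measurable]: "(\<lambda>m. g (m 0)) \<in> borel_measurable \<mu>"
    by (rule measurable_compose[OF measurable_digit]) simp
  have F: "F \<in> borel_measurable \<mu>"
    unfolding F_def using K(1) by (intro borel_measurable_add borel_measurable_times gm) auto
  have gb: "\<bar>g (m 0)\<bar> \<le> potential_bound s" if "m \<in> symbolic_space M" for m
    unfolding g_def by (rule potential_bound[OF symbolic_space_digit[OF that]])
  define b where "b = L + potential_bound s + \<kappa>"
  have Fb: "\<bar>F m\<bar> \<le> b" if "m \<in> symbolic_space M" for m
    using gb[OF that] L(1) \<kappa> unfolding F_def b_def indicator_def by (auto split: if_splits)
  have ig: "integrable \<mu> (\<lambda>m. g (m 0))"
    using gb by (intro integrable_bounded[where b="potential_bound s"]) auto
  have ii: "integrable \<mu> (\<lambda>m. L * indicator (space \<mu> - K) m)"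
    using K(1) by (intro integrable_mult_right integrable_real_indicator) (auto simp: less_top[symmetric])
  have "(\<integral>m. F m \<partial>\<mu>) = (\<integral>m. L * indicator (space \<mu> - K) m \<partial>\<mu>) + (\<integral>m. g (m 0) + \<kappa> \<partial>\<mu>)"
    unfolding F_def using ig by (intro Bochner_Integration.integral_add ii) auto
  also have "(\<integral>m. g (m 0) + \<kappa> \<partial>\<mu>) = (\<integral>m. g (m 0) \<partial>\<mu>) + \<kappa>"
    using ig by (subst Bochner_Integration.integral_add) (auto simp: mu.prob_space)
  also have "(\<integral>m. g (m 0) \<partial>\<mu>) = s * lyapunov - entropy"
    unfolding g_def by (rule integral_potential)
  also have "(\<integral>m. L * indicator (space \<mu> - K) m \<partial>\<mu>) = L * mu.prob (space \<mu> - K)"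
    using K(1) by simp
  also have "L * mu.prob (space \<mu> - K) + (s * lyapunov - entropy + \<kappa>) < 0"
    using K(2) L(1) \<kappa> by (simp add: \<kappa>_def field_simps)
  finally have "(\<integral>m. F m \<partial>\<mu>) < 0" .
  define A where "A = {m \<in> space \<mu>. \<forall>n. birkhoff_sum F n m \<le> 0}"
  have Apos: "0 < mu.prob A"
    unfolding A_def by (rule maximal_ergodic[OF F Fb \<open>(\<integral>m. F m \<partial>\<mu>) < 0\<close>])
  have Am: "A \<in> sets \<mu>"
    unfolding A_def using birkhoff_sum_measurable[OF F] by measurable
  define bad where "bad n m = {k. k < n \<and> (\<lambda>j. m (j + k)) \<notin> K}" for n m
  have weight: "word_prod q m n \<le> word_prod r m n powr s * (exp (- (\<kappa> * real n)) * exp (- L) ^ card (bad n m))"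
    if m: "m \<in> A" for m n
  proof -
    have mS: "m \<in> symbolic_space M" using m by (simp add: A_def space_mu)
    have qp: "0 < word_prod q m n" using q_pos symbolic_space_digit[OF mS] by (intro word_prod_pos) blast
    have rp: "0 < word_prod r m n" using symbolic_space_digit[OF mS] by (intro word_prod_r_pos) blast
    have "indicator (space \<mu> - K) (\<lambda>j. m (j + k)) = (if (\<lambda>j. m (j + k)) \<notin> K then 1 else 0 :: real)" for k
      using symbolic_space_shift_iterate[OF mS, of k] by (simp add: indicator_def space_mu)
    then have "(\<Sum>k<n. indicator (space \<mu> - K) (\<lambda>j. m (j + k))) = (\<Sum>k<n. if (\<lambda>j. m (j + k)) \<notin> K then 1 else 0 :: real)"
      by simp
    also have "\<dots> = real (card (bad n m))"
    proof -
      have "{..<n} \<inter> {k. (\<lambda>j. m (j + k)) \<notin> K} = bad n m" by (auto simp: bad_def)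
      then show ?thesis by (simp add: sum.If_cases)
    qed
    finally have visits: "(\<Sum>k<n. indicator (space \<mu> - K) (\<lambda>j. m (j + k))) = real (card (bad n m))" .
    have "birkhoff_sum F n m = L * (\<Sum>k<n. indicator (space \<mu> - K) (\<lambda>j. m (j + k))) + (\<Sum>k<n. g (m k)) + \<kappa> * real n"
      by (simp add: birkhoff_sum_def F_def sum.distrib sum_distrib_left)
    also have "(\<Sum>k<n. g (m k)) = ln (word_prod q m n) - s * ln (word_prod r m n)"
      by (simp add: g_def ln_word_prod_q[OF mS] ln_word_prod_r[OF mS] sum_subtractf sum_distrib_left)
    also note visits
    finally have total: "birkhoff_sum F n m
      = L * real (card (bad n m)) + (ln (word_prod q m n) - s * ln (word_prod r m n)) + \<kappa> * real n" .
    have "birkhoff_sum F n m \<le> 0"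
      using m by (simp add: A_def)
    with total have "ln (word_prod q m n) \<le> s * ln (word_prod r m n) + (- (\<kappa> * real n) + real (card (bad n m)) * - L)"
      by (simp add: mult.commute[of L])
    then have "exp (ln (word_prod q m n)) \<le> exp (s * ln (word_prod r m n) + (- (\<kappa> * real n) + real (card (bad n m)) * - L))"
      by simp
    then show ?thesis
      using qp rp unfolding exp_add exp_of_nat_mult by (simp add: powr_def)
  qed
  define \<theta> where "\<theta> = exp (- (\<kappa> / 2))"
  have \<theta>: "0 < \<theta>" "\<theta> < 1" using \<kappa> by (auto simp: \<theta>_def)
  define C where "C = (2 / c) powr s / (1 - \<theta>)"
  have Cpos: "0 < C" using c \<theta> by (simp add: C_def)
  have frost: "emeasure \<mu> {m \<in> A. coding_map r u m \<in> cball x \<rho>} \<le> ennreal (C * \<rho> powr s)" if \<rho>: "0 < \<rho>" for x \<rho>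
  proof -
    define Q where "Q = {m \<in> A. coding_map r u m \<in> cball x \<rho>}"
    have QS: "m \<in> symbolic_space M" if "m \<in> Q" for m using that by (simp add: Q_def A_def space_mu)
    \<comment> \<open>The first time at which the contraction ratio falls below the scale \<open>2 \<rho> / c\<close>.\<close>
    define stop where "stop m = (LEAST n. c * word_prod r m n \<le> 2 * \<rho>)" for m
    have stop: "c * word_prod r m (stop m) \<le> 2 * \<rho>" "\<And>k. k < stop m \<Longrightarrow> 2 * \<rho> < c * word_prod r m k" if "m \<in> Q" for m
    proof -
      obtain n where n: "max_ratio ^ n < 2 * \<rho> / c"
        using real_arch_pow_inv[of "2 * \<rho> / c" max_ratio] max_ratio c \<rho> by auto
      have "word_prod r m n \<le> max_ratio ^ n"
        using symbolic_space_digit[OF QS[OF that]] by (intro word_prod_r_le) blast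
      with n have "word_prod r m n \<le> 2 * \<rho> / c" by linarith
      then have "c * word_prod r m n \<le> 2 * \<rho>" using c by (simp add: field_simps)
      then show "c * word_prod r m (stop m) \<le> 2 * \<rho>" unfolding stop_def by (rule LeastI)
      show "2 * \<rho> < c * word_prod r m k" if "k < stop m" for k
        using not_less_Least[OF that[unfolded stop_def]] by simp
    qed
    define QQ where "QQ n S = {m \<in> Q. stop m = n \<and> bad n m = S}" for n S
    define V where "V n S = (\<lambda>m. restrict m {..<n}) ` QQ n S" for n S
    have Vw: "V n S \<subseteq> words M n" for n S
      unfolding V_def QQ_def using QS restrict_in_words by auto
    have finV: "finite (V n S)" for n S
      using finite_subset[OF Vw] by simp
    have cardV: "card (V n S) \<le> M ^ card S" for n S
      unfolding V_def
    proof (rule card_words_same_bad_times[where c=c and \<delta>="2 * \<rho>" and K=K, OF sep])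
      show "QQ n S \<subseteq> symbolic_space M" using QS by (auto simp: QQ_def)
      show "\<bar>coding_map r u m - coding_map r u m'\<bar> \<le> 2 * \<rho>" if "m \<in> QQ n S" "m' \<in> QQ n S" for m m'
        using that by (auto simp: QQ_def Q_def dist_real_def)
      show "2 * \<rho> < c * word_prod r m k" if "m \<in> QQ n S" "k < n" for m k
        using that stop(2)[of m k] by (auto simp: QQ_def)
      show "{k. k < n \<and> (\<lambda>j. m (j + k)) \<notin> K} = S" if "m \<in> QQ n S" for m
        using that by (simp add: QQ_def bad_def)
    qed
    define B where "B = (2 * \<rho> / c) powr s"
    have B0: "0 \<le> B" by (simp add: B_def)
    have cyl: "emeasure \<mu> (cylinder M w n) \<le> ennreal (B * (exp (- (\<kappa> * real n)) * exp (- L) ^ card S))"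
      if w: "w \<in> V n S" for w n S
    proof -
      obtain m where m: "m \<in> Q" "stop m = n" "bad n m = S" "w = restrict m {..<n}"
        using w unfolding V_def QQ_def by blast
      have wp: "word_prod f w n = word_prod f m n" for f
        unfolding m(4) by (rule word_prod_cong) simp
      have "emeasure \<mu> (cylinder M w n) = ennreal (word_prod q m n)"
        unfolding wp[symmetric] using w Vw words_digit by (intro emeasure_cylinder) blast
      also have "\<dots> \<le> ennreal (word_prod r m n powr s * (exp (- (\<kappa> * real n)) * exp (- L) ^ card (bad n m)))"
        using m(1) by (intro ennreal_leI weight) (simp add: Q_def)
      also have "\<dots> \<le> ennreal (B * (exp (- (\<kappa> * real n)) * exp (- L) ^ card S))"
      proof -
        have "word_prod r m n \<le> 2 * \<rho> / c" using stop(1)[OF m(1)] m(2) c by (simp add: field_simps)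
        moreover have "0 \<le> word_prod r m n"
          using word_prod_r_pos[of n m] symbolic_space_digit[OF QS[OF m(1)]] by (simp add: less_imp_le)
        ultimately have "word_prod r m n powr s \<le> B" unfolding B_def using s(1) by (intro powr_mono2)
        then show ?thesis unfolding m(3) by (intro ennreal_leI mult_right_mono) auto
      qed
      finally show ?thesis .
    qed
    have level: "emeasure \<mu> (\<Union>S\<in>Pow {..<n}. \<Union>w\<in>V n S. cylinder M w n) \<le> ennreal (B * \<theta> ^ n)" for n
    proof -
      define t where "t = exp (- L)"
      have t: "0 < t" by (simp add: t_def)
      have "emeasure \<mu> (\<Union>S\<in>Pow {..<n}. \<Union>w\<in>V n S. cylinder M w n)
          \<le> (\<Sum>S\<in>Pow {..<n}. emeasure \<mu> (\<Union>w\<in>V n S. cylinder M w n))"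
        using finV by (intro emeasure_subadditive_finite) auto
      also have "\<dots> \<le> (\<Sum>S\<in>Pow {..<n}. ennreal (B * exp (- (\<kappa> * real n)) * (real M * t) ^ card S))"
      proof (rule sum_mono)
        fix S
        have "emeasure \<mu> (\<Union>w\<in>V n S. cylinder M w n) \<le> (\<Sum>w\<in>V n S. emeasure \<mu> (cylinder M w n))"
          using finV by (intro emeasure_subadditive_finite) auto
        also have "\<dots> \<le> (\<Sum>w\<in>V n S. ennreal (B * (exp (- (\<kappa> * real n)) * t ^ card S)))"
          unfolding t_def by (intro sum_mono cyl)
        also have "\<dots> = ennreal (real (card (V n S)) * (B * (exp (- (\<kappa> * real n)) * t ^ card S)))"
          using B0 t by (simp add: ennreal_mult ennreal_of_nat_eq_real_of_nat)
        also have "\<dots> \<le> ennreal (real (M ^ card S) * (B * (exp (- (\<kappa> * real n)) * t ^ card S)))"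
          using cardV[of n S] B0 t by (intro ennreal_leI mult_right_mono of_nat_mono) auto
        also have "real (M ^ card S) * (B * (exp (- (\<kappa> * real n)) * t ^ card S)) = B * exp (- (\<kappa> * real n)) * (real M * t) ^ card S"
          by (simp add: power_mult_distrib)
        finally show "emeasure \<mu> (\<Union>w\<in>V n S. cylinder M w n) \<le> ennreal (B * exp (- (\<kappa> * real n)) * (real M * t) ^ card S)" .
      qed
      also have "\<dots> = ennreal (\<Sum>S\<in>Pow {..<n}. B * exp (- (\<kappa> * real n)) * (real M * t) ^ card S)"
        using B0 t by (intro sum_ennreal) auto
      also have "(\<Sum>S\<in>Pow {..<n}. B * exp (- (\<kappa> * real n)) * (real M * t) ^ card S) = B * exp (- (\<kappa> * real n)) * (real M * t + 1) ^ n"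
        using sum_Pow_card[of "{..<n}" "real M * t"] by (simp add: sum_distrib_left[symmetric])
      also have "\<dots> \<le> B * exp (- (\<kappa> * real n)) * exp (\<kappa> / 2) ^ n"
        using L(2) B0 t unfolding t_def[symmetric] by (intro mult_left_mono power_mono) auto
      also have "B * exp (- (\<kappa> * real n)) * exp (\<kappa> / 2) ^ n = B * \<theta> ^ n"
        by (simp add: \<theta>_def exp_of_nat_mult[symmetric] exp_add[symmetric])
      finally show ?thesis by (simp add: ennreal_leI)
    qed
    have "Q \<subseteq> (\<Union>n. \<Union>S\<in>Pow {..<n}. \<Union>w\<in>V n S. cylinder M w n)"
    proof
      fix m assume m: "m \<in> Q"
      let ?n = "stop m" let ?S = "bad (stop m) m"
      have "restrict m {..<?n} \<in> V ?n ?S" using m by (auto simp: V_def QQ_def)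
      moreover have "m \<in> cylinder M (restrict m {..<?n}) ?n" by (rule mem_cylinder_restrict[OF QS[OF m]])
      moreover have "?S \<in> Pow {..<?n}" by (auto simp: bad_def)
      ultimately show "m \<in> (\<Union>n. \<Union>S\<in>Pow {..<n}. \<Union>w\<in>V n S. cylinder M w n)" by blast
    qed
    moreover have meas: "(\<Union>S\<in>Pow {..<n}. \<Union>w\<in>V n S. cylinder M w n) \<in> sets \<mu>" for n
      using finV by (intro sets.finite_UN) auto
    ultimately have "emeasure \<mu> Q \<le> emeasure \<mu> (\<Union>n. \<Union>S\<in>Pow {..<n}. \<Union>w\<in>V n S. cylinder M w n)"
      by (intro emeasure_mono) auto
    also have "\<dots> \<le> (\<Sum>n. emeasure \<mu> (\<Union>S\<in>Pow {..<n}. \<Union>w\<in>V n S. cylinder M w n))"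
      using meas by (intro emeasure_subadditive_countably) auto
    also have "\<dots> \<le> (\<Sum>n. ennreal (B * \<theta> ^ n))"
      by (intro suminf_le level) auto
    also have "\<dots> = ennreal (B * (1 / (1 - \<theta>)))"
      using \<theta> B0 by (intro suminf_ennreal_eq sums_mult geometric_sums) auto
    also have "B * (1 / (1 - \<theta>)) = C * \<rho> powr s"
    proof -
      have "B = (2 / c) powr s * \<rho> powr s"
        unfolding B_def using powr_mult[of "2 / c" \<rho> s] c \<rho> by simp
      then show ?thesis by (simp add: C_def)
    qed
    finally show ?thesis unfolding Q_def .
  qed
  show thesis by (rule that[OF Am Apos Cpos frost])
qed

text \<open>The mass distribution principle.  A covering set \<open>U\<close> is replaced by a closed ball of radius
  its diameter; sets of diameter \<open>0\<close> are handled by letting the radius tend to \<open>0\<close>.\<close>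

lemma hausdorff_measure_pos:
  assumes A: "A \<in> sets \<mu>" "0 < mu.prob A" and C: "0 < C" and s: "0 \<le> s"
    and frost: "\<And>x \<rho>. 0 < \<rho> \<Longrightarrow> emeasure \<mu> {m \<in> A. coding_map r u m \<in> cball x \<rho>} \<le> ennreal (C * \<rho> powr s)"
    and X: "X \<in> sets borel" "emeasure \<nu> X = 1"
  shows "hausdorff_measure s X \<noteq> 0"
proof
  assume "hausdorff_measure s X = 0"
  moreover have "hausdorff_premeasure s 1 X \<le> hausdorff_measure s X"
    unfolding hausdorff_measure_def by (rule SUP_upper) simp
  ultimately have "hausdorff_premeasure s 1 X = 0" by simp
  then have "(INF U\<in>delta_covers 1 X. \<Sum>i. hausdorff_weight s (U i)) < ennreal (mu.prob A / C)"
    unfolding hausdorff_premeasure_def using A(2) C by simp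
  then obtain U where U: "U \<in> delta_covers 1 X" "(\<Sum>i. hausdorff_weight s (U i)) < ennreal (mu.prob A / C)"
    unfolding INF_less_iff by blast
  have Ub: "bounded (U i)" for i using U(1) by (auto simp: delta_covers_def)
  have AS: "A \<subseteq> symbolic_space M" using sets.sets_into_space[OF A(1)] by (simp add: space_mu)
  define T where "T i = (if U i = {} then {} else {m \<in> A. coding_map r u m \<in> cball (SOME x. x \<in> U i) (diameter (U i))})" for i
  have Tm: "{m \<in> A. coding_map r u m \<in> cball x \<rho>} \<in> sets \<mu>" for x \<rho>
  proof -
    have "{m \<in> A. coding_map r u m \<in> cball x \<rho>} = A \<inter> {m \<in> symbolic_space M. coding_map r u m \<in> cball x \<rho>}"
      using AS by auto
    then show ?thesis using A(1) coding_preimage_sets[of "cball x \<rho>"] by auto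
  qed
  have T: "T i \<in> sets \<mu>" for i unfolding T_def using Tm by auto
  have Tle: "emeasure \<mu> (T i) \<le> ennreal C * hausdorff_weight s (U i)" for i
  proof (cases "U i = {}")
    case False
    define x where "x = (SOME x. x \<in> U i)"
    have Ti: "T i = {m \<in> A. coding_map r u m \<in> cball x (diameter (U i))}"
      using False by (simp add: T_def x_def)
    have le: "emeasure \<mu> (T i) \<le> ennreal (C * \<rho> powr s)" if "0 < \<rho>" "diameter (U i) \<le> \<rho>" for \<rho>
    proof -
      have "emeasure \<mu> (T i) \<le> emeasure \<mu> {m \<in> A. coding_map r u m \<in> cball x \<rho>}"
        unfolding Ti using that(2) by (intro emeasure_mono Tm) auto
      with frost[OF that(1), of x] show ?thesis by (rule order_trans[rotated])
    qed
    consider "s = 0" | "s \<noteq> 0" "0 < diameter (U i)" | "s \<noteq> 0" "diameter (U i) = 0"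
      using diameter_ge_0[OF Ub[of i]] by linarith
    then show ?thesis
    proof cases
      case 1
      have "diameter (U i) \<le> 1" using U(1) by (simp add: delta_covers_def)
      from le[OF _ this] show ?thesis using 1 False by (simp add: hausdorff_weight_def)
    next
      case 2
      from le[OF 2(2) order_refl] show ?thesis
        using 2 False C by (simp add: hausdorff_weight_def ennreal_mult)
    next
      case 3
      have eps: "emeasure \<mu> (T i) \<le> 0 + ennreal e" if "0 < e" for e
      proof -
        have "emeasure \<mu> (T i) \<le> ennreal (C * ((e / C) powr (1 / s)) powr s)"
          using that C 3 by (intro le) auto
        also have "C * ((e / C) powr (1 / s)) powr s = e"
          using that C 3 by (simp add: powr_powr)
        finally show ?thesis by simp
      qed
      have "emeasure \<mu> (T i) \<le> 0"
        by (rule ennreal_le_epsilon) (rule eps)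
      then show ?thesis by simp
    qed
  qed (simp add: T_def)
  have "emeasure \<mu> A = emeasure \<mu> {m \<in> A. coding_map r u m \<in> X}"
  proof (rule emeasure_eq_AE)
    have "AE x in \<nu>. x \<in> X"
      using X by (subst nu.AE_in_set_eq_1) (auto simp: measure_def)
    then have "AE m in \<mu>. coding_map r u m \<in> X"
      unfolding self_similar_measure_def using X(1) by (subst (asm) AE_distr_iff) auto
    then show "AE m in \<mu>. m \<in> A \<longleftrightarrow> m \<in> {m \<in> A. coding_map r u m \<in> X}" by eventually_elim simp
    have "{m \<in> A. coding_map r u m \<in> X} = A \<inter> {m \<in> symbolic_space M. coding_map r u m \<in> X}"
      using AS by auto
    then show "{m \<in> A. coding_map r u m \<in> X} \<in> sets \<mu>"
      using A(1) coding_preimage_sets[OF X(1)] by auto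
  qed (rule A(1))
  also have "\<dots> \<le> emeasure \<mu> (\<Union>i. T i)"
  proof (rule emeasure_mono)
    show "{m \<in> A. coding_map r u m \<in> X} \<subseteq> (\<Union>i. T i)"
    proof
      fix m assume m: "m \<in> {m \<in> A. coding_map r u m \<in> X}"
      then obtain i where i: "coding_map r u m \<in> U i" using U(1) by (auto simp: delta_covers_def)
      then have "(SOME x. x \<in> U i) \<in> U i" by (rule someI)
      then have "dist (SOME x. x \<in> U i) (coding_map r u m) \<le> diameter (U i)"
        using diameter_bounded_bound[OF Ub] i by blast
      then show "m \<in> (\<Union>i. T i)" using m i by (auto simp: T_def intro!: exI[of _ i])
    qed
  qed (use T in auto)
  also have "\<dots> \<le> (\<Sum>i. emeasure \<mu> (T i))"
    using T by (intro emeasure_subadditive_countably) auto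
  also have "\<dots> \<le> (\<Sum>i. ennreal C * hausdorff_weight s (U i))"
    by (intro suminf_le Tle) auto
  also have "\<dots> = ennreal C * (\<Sum>i. hausdorff_weight s (U i))"
    by (rule ennreal_suminf_cmult)
  also have "\<dots> < ennreal C * ennreal (mu.prob A / C)"
    using U(2) C by (intro ennreal_mult_strict_left_mono) auto
  also have "\<dots> = emeasure \<mu> A"
    using C A(2) by (simp add: ennreal_mult[symmetric] mu.emeasure_eq_measure)
  finally show False by simp
qed

lemma dim_measure_lower:
  assumes N: "N \<in> null_sets \<mu>"
    and uniq: "\<And>m. m \<in> symbolic_space M - N \<Longrightarrow> card (coding_fibre M r u m - N) = 1"
  shows "ereal (entropy / lyapunov) \<le> hausdorff_dim_measure \<nu>"
  unfolding hausdorff_dim_measure_def hausdorff_dim_def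
proof (intro INF_greatest)
  fix X t assume X: "X \<in> {A \<in> sets \<nu>. emeasure \<nu> A = 1}" and t: "t \<in> {s. 0 \<le> s \<and> hausdorff_measure s X = 0}"
  have inj: "inj_on (coding_map r u) (symbolic_space M - N)"
  proof (rule inj_onI)
    fix m m' assume m: "m \<in> symbolic_space M - N" "m' \<in> symbolic_space M - N"
      "coding_map r u m = coding_map r u m'"
    have "m \<in> coding_fibre M r u m - N" "m' \<in> coding_fibre M r u m - N"
      using m by (auto simp: coding_fibre_def)
    then show "m = m'" using uniq[OF m(1)] by (metis card_1_singletonE singletonD)
  qed
  show "ereal (entropy / lyapunov) \<le> ereal t"
  proof (rule ccontr)
    assume "\<not> ?thesis"
    then have "t * lyapunov < entropy" using lyapunov_pos by (simp add: field_simps)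
    then obtain A C where A: "A \<in> sets \<mu>" "0 < mu.prob A" "0 < C"
      "\<And>x \<rho>. 0 < \<rho> \<Longrightarrow> emeasure \<mu> {m \<in> A. coding_map r u m \<in> cball x \<rho>} \<le> ennreal (C * \<rho> powr t)"
      using frostman_subset[OF N _ _ inj, of t] t by blast
    have "hausdorff_measure t X \<noteq> 0"
      by (rule hausdorff_measure_pos[OF A(1-3) _ A(4)]) (use t X in auto)
    then show False using t by simp
  qed
qed

lemma full_dimension_iff_unique_coding:
  "hausdorff_dim_measure \<nu> = ereal (entropy / lyapunov) \<longleftrightarrow>
    (\<exists>B \<in> null_sets \<mu>. \<forall>m \<in> symbolic_space M - B. card (coding_fibre M r u m - B) = 1)"
proof
  assume full: "hausdorff_dim_measure \<nu> = ereal (entropy / lyapunov)"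
  show "\<exists>B \<in> null_sets \<mu>. \<forall>m \<in> symbolic_space M - B. card (coding_fibre M r u m - B) = 1"
  proof (rule unique_coding_if_unambiguous)
    fix i E a assume "i \<in> {1..M}" "ambiguous i E a" "a < 1"
    then show "mu.prob (visit i E) = 0"
      using dimension_drop[of i E a] full by (auto simp: zero_less_measure_iff)
  qed
next
  assume "\<exists>B \<in> null_sets \<mu>. \<forall>m \<in> symbolic_space M - B. card (coding_fibre M r u m - B) = 1"
  then show "hausdorff_dim_measure \<nu> = ereal (entropy / lyapunov)"
    using dim_measure_lower dim_measure_upper by (blast intro: antisym)
qed

end

theorem propositionA1:
  fixes M :: nat and r u :: "nat \<Rightarrow> real"
  assumes "1 \<le> M"
    and "\<And>i. i \<in> {1..M} \<Longrightarrow> 0 < r i \<and> r i < 1"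
  shows "no_dimension_drop M r u \<longleftrightarrow> weak_almost_unique_coding M r u"
proof -
  have "hausdorff_dim_measure (self_similar_measure M r u q) =
      ereal ((- (\<Sum>i\<in>{1..M}. q i * ln (q i))) / (- (\<Sum>i\<in>{1..M}. q i * ln (r i)))) \<longleftrightarrow>
    (\<exists>B \<in> null_sets (bernoulli_measure M q).
      \<forall>m \<in> symbolic_space M - B. card (coding_fibre M r u m - B) = 1)"
    if "positive_prob_vector M q" for q
  proof -
    interpret bernoulli_ifs M r u q
      using assms(2) that by unfold_locales
    show ?thesis
      using full_dimension_iff_unique_coding unfolding entropy_def lyapunov_def .
  qed
  then show ?thesis
    unfolding no_dimension_drop_def weak_almost_unique_coding_def by blast
qed

end
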